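(* Let $X_0\in L^1(\mathcal{O})$, let $z\in C([0,T];\mathbb{R}^N)$ be of bounded variation, and let $X\in L^1(\mathcal{O}_T)$ be such that, for each $k=1,\dots,N$, the map $t\mapsto\int_{\mathcal{O}} f_kX_t\eta_t\,d\xi$ is continuous on $[0,T]$ for all $\eta\in C^{0,2}(\bar{\mathcal{O}}_T)$ with $\eta=0$ on $\mathcal{P}\mathcal{O}_T$. Then $X$ is a very weak solution to the rough equation with initial value $X_0$ if and only if $Y:=e^{\mu}X$ is a very weak solution to the transformed equation with initial value $Y_0:=e^{\mu_0}X_0$.
   Context: Setting: $\mathcal{O}\subseteq\mathbb{R}^d$ is a smooth bounded domain, $T>0$, $\mathcal{O}_T=[0,T]\times\mathcal{O}$, $1<m<\infty$, $\Phi(r)=|r|^m\operatorname{sgn}(r)$, $f_1,\dots,f_N\in C^\infty(\bar{\mathcal{O}})$. $C^{j,k}(\bar{\mathcal{O}}_T)$ denotes continuous functions with $j$ continuous time derivatives and $k$ continuous space derivatives. The (time-inverted) parabolic boundary is $\mathcal{P}\mathcal{O}_T=[0,T]\times\partial\mathcal{O}\ \cup\ \{T\}\times\mathcal{O}$. For a driving signal $z=(z^{(1)},\dots,z^{(N)})$ put $\mu_t(\xi)=-\sum_{k=1}^N f_k(\xi)z^{(k)}_t$. Rough equation: $dX_t=\Delta\Phi(X_t)\,dt+\sum_{k=1}^N f_kX_t\circ dz^{(k)}_t$ on $\mathcal{O}_T$, $X(0)=X_0$, with homogeneous Dirichlet boundary conditions. Transformed equation: $\partial_tY_t=e^{\mu_t}\Delta\Phi(e^{-\mu_t}Y_t)$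 on $\mathcal{O}_T$, $Y(0)=Y_0$, with homogeneous Dirichlet boundary conditions. Very weak solution to the transformed equation ($Y_0\in L^1(\mathcal{O})$): $Y\in L^1(\mathcal{O}_T)$ with $\Phi(e^{-\mu}Y)\in L^1(\mathcal{O}_T)$ and $$-\int_{\mathcal{O}_T}Y_r\partial_r\eta\,d\xi\,dr-\int_{\mathcal{O}}Y_0\eta_0\,d\xi=\int_{\mathcal{O}_T}\Phi(e^{-\mu_r}Y_r)\,\Delta(e^{\mu_r}\eta_r)\,d\xi\,dr$$ for all $\eta\in C^{1,2}(\bar{\mathcal{O}}_T)$ with $\eta=0$ on $\mathcal{P}\mathcal{O}_T$. Very weak solution to the rough equation ($z$ continuous of bounded variation, $X_0\in L^1(\mathcal{O})$): $X\in L^1(\mathcal{O}_T)$ such that $t\mapsto\int_{\mathcal{O}}f_kX_t\eta_t\,d\xi$ is continuous for each $k$ and each test function $\eta$, $\Phi(X)\in L^1(\mathcal{O}_T)$, and $$-\int_{\mathcal{O}_T}X_r\partial_r\eta\,d\xi\,dr-\int_{\mathcal{O}}X_0\eta_0\,d\xi=\int_{\mathcal{O}_T}\Phi(X_r)\Delta\eta_r\,d\xi\,dr+\sum_{k=1}^N\int_0^T\Big(\int_{\mathcal{O}}f_kX_r\eta_r\,d\xi\Big)dz^{(k)}_r$$ (Riemann–Stieltjes integral) for all $\eta\in C^{1,2}(\bar{\mathcal{O}}_T)$ with $\eta=0$ on $\mathcal{P}\mathcal{O}_T$. *)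

theory Defs
  imports "HOL-Analysis.Analysis"
begin

text \<open>
  Differentiability classes are described by a family of continuous functions, indexed by a list
  of coordinate directions, that are the iterated partial derivatives of the first one.
  A function belongs to a class ``up to the closure'' if its derivatives, taken in the open set,
  extend continuously to the closure.
\<close>

text \<open>
  \<open>smooth_upto S C u\<close>: all partial derivatives of \<open>u\<close> exist in the open set \<open>S\<close> and
  extend continuously to \<open>C\<close>. With \<open>C = S\<close> this is \<open>u \<in> C\<^sup>\<infinity>(S)\<close>, and with
  \<open>C = closure S\<close> it is \<open>C\<^sup>\<infinity>\<close> up to the closure.
\<close>
definition smooth_upto :: "'a::euclidean_space set \<Rightarrow> 'a set \<Rightarrow> ('a \<Rightarrow> real) \<Rightarrow> bool" where
  "smooth_upto S C u \<longleftrightarrow>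
    (\<exists>D :: 'a list \<Rightarrow> 'a \<Rightarrow> real. D [] = u \<and>
      (\<forall>bs. set bs \<subseteq> Basis \<longrightarrow> continuous_on C (D bs)) \<and>
      (\<forall>bs. \<forall>b\<in>Basis. \<forall>x\<in>S. set bs \<subseteq> Basis \<longrightarrow>
         ((\<lambda>h. D bs (x + h *\<^sub>R b)) has_real_derivative D (b # bs) x) (at 0)))"

text \<open>The boundary is locally a regular level set of a smooth function, with the domain on one
  side of it.\<close>
definition smooth_bounded_domain :: "'a::euclidean_space set \<Rightarrow> bool" where
  "smooth_bounded_domain \<Omega> \<longleftrightarrow>
    open \<Omega> \<and> connected \<Omega> \<and> bounded \<Omega> \<and> \<Omega> \<noteq> {} \<and>
    (\<forall>p\<in>frontier \<Omega>. \<exists>U \<rho>. open U \<and> p \<in> U \<and> smooth_upto U U \<rho> \<and>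
       (\<exists>b\<in>Basis. deriv (\<lambda>h. \<rho> (p + h *\<^sub>R b)) 0 \<noteq> 0) \<and>
       \<Omega> \<inter> U = {x \<in> U. \<rho> x < 0} \<and> frontier \<Omega> \<inter> U = {x \<in> U. \<rho> x = 0})"

text \<open>
  The class \<open>C\<^sup>j\<^sup>,\<^sup>k\<close> on the closed cylinder: \<open>j\<close> continuous time derivatives
  (one-sided at the end points of \<open>{0..T}\<close>) and \<open>k\<close> continuous space derivatives; no mixed
  derivatives are required.
\<close>
definition C_time_space ::
    "nat \<Rightarrow> nat \<Rightarrow> real \<Rightarrow> 'a::euclidean_space set \<Rightarrow> (real \<Rightarrow> 'a \<Rightarrow> real) \<Rightarrow> bool" where
  "C_time_space j k T \<Omega> \<eta> \<longleftrightarrow>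
    (\<exists>D :: nat \<Rightarrow> real \<Rightarrow> 'a \<Rightarrow> real. D 0 = \<eta> \<and>
      (\<forall>i\<le>j. continuous_on ({0..T} \<times> closure \<Omega>) (\<lambda>(t, x). D i t x)) \<and>
      (\<forall>i<j. \<forall>t\<in>{0..T}. \<forall>x\<in>closure \<Omega>.
         ((\<lambda>s. D i s x) has_real_derivative D (Suc i) t x) (at t within {0..T}))) \<and>
    (\<exists>D :: 'a list \<Rightarrow> real \<Rightarrow> 'a \<Rightarrow> real. D [] = \<eta> \<and>
      (\<forall>bs. set bs \<subseteq> Basis \<and> length bs \<le> k \<longrightarrow>
         continuous_on ({0..T} \<times> closure \<Omega>) (\<lambda>(t, x). D bs t x)) \<and>
      (\<forall>bs. \<forall>b\<in>Basis. \<forall>t\<in>{0..T}. \<forall>x\<in>\<Omega>. set bs \<subseteq> Basis \<and> length bs < k \<longrightarrow>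
         ((\<lambda>h. D bs t (x + h *\<^sub>R b)) has_real_derivative D (b # bs) t x) (at 0)))"

text \<open>The time-inverted parabolic boundary: lateral boundary and terminal time slice.\<close>
definition parabolic_boundary :: "real \<Rightarrow> 'a::euclidean_space set \<Rightarrow> (real \<times> 'a) set" where
  "parabolic_boundary T \<Omega> = {0..T} \<times> frontier \<Omega> \<union> {T} \<times> \<Omega>"

definition test_function ::
    "nat \<Rightarrow> real \<Rightarrow> 'a::euclidean_space set \<Rightarrow> (real \<Rightarrow> 'a \<Rightarrow> real) \<Rightarrow> bool" where
  "test_function j T \<Omega> \<eta> \<longleftrightarrow>
    C_time_space j 2 T \<Omega> \<eta> \<and> (\<forall>(t, x)\<in>parabolic_boundary T \<Omega>. \<eta> t x = 0)"

definition time_derivative ::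
    "real \<Rightarrow> (real \<Rightarrow> 'a::euclidean_space \<Rightarrow> real) \<Rightarrow> real \<Rightarrow> 'a \<Rightarrow> real" where
  "time_derivative T \<eta> t x = vector_derivative (\<lambda>s. \<eta> s x) (at t within {0..T})"

definition laplacian :: "('a::euclidean_space \<Rightarrow> real) \<Rightarrow> 'a \<Rightarrow> real" where
  "laplacian u x = (\<Sum>b\<in>Basis. (deriv ^^ 2) (\<lambda>h. u (x + h *\<^sub>R b)) 0)"

definition bounded_variation_on_interval ::
    "real \<Rightarrow> real \<Rightarrow> (real \<Rightarrow> 'b::real_normed_vector) \<Rightarrow> bool" where
  "bounded_variation_on_interval a b z \<longleftrightarrow>
    (\<exists>M. \<forall>n (t :: nat \<Rightarrow> real).
       t 0 = a \<and> t n = b \<and> (\<forall>i<n. t i \<le> t (Suc i)) \<longrightarrow>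
       (\<Sum>i<n. norm (z (t (Suc i)) - z (t i))) \<le> M)"

text \<open>Limit of the tagged sums as the mesh of the partition tends to zero.\<close>
definition has_RS_integral ::
    "(real \<Rightarrow> real) \<Rightarrow> (real \<Rightarrow> real) \<Rightarrow> real \<Rightarrow> real \<Rightarrow> real \<Rightarrow> bool" where
  "has_RS_integral g z a b I \<longleftrightarrow>
    (\<forall>\<epsilon>>0. \<exists>\<delta>>0. \<forall>n (t :: nat \<Rightarrow> real) (s :: nat \<Rightarrow> real).
       t 0 = a \<and> t n = b \<and>
       (\<forall>i<n. t i \<le> s i \<and> s i \<le> t (Suc i) \<and> t (Suc i) - t i < \<delta>) \<longrightarrow>
       \<bar>(\<Sum>i<n. g (s i) * (z (t (Suc i)) - z (t i))) - I\<bar> < \<epsilon>)"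

definition RS_integral :: "(real \<Rightarrow> real) \<Rightarrow> (real \<Rightarrow> real) \<Rightarrow> real \<Rightarrow> real \<Rightarrow> real" where
  "RS_integral g z a b = (THE I. has_RS_integral g z a b I)"

definition L1 :: "'a::euclidean_space set \<Rightarrow> ('a \<Rightarrow> real) \<Rightarrow> bool" where
  "L1 S u \<longleftrightarrow> set_integrable lebesgue S u"

definition L1_cyl ::
    "real \<Rightarrow> 'a::euclidean_space set \<Rightarrow> (real \<Rightarrow> 'a \<Rightarrow> real) \<Rightarrow> bool" where
  "L1_cyl T \<Omega> X \<longleftrightarrow> set_integrable lebesgue ({0..T} \<times> \<Omega>) (\<lambda>(t, x). X t x)"

definition integral_cyl ::
    "real \<Rightarrow> 'a::euclidean_space set \<Rightarrow> (real \<Rightarrow> 'a \<Rightarrow> real) \<Rightarrow> real" where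
  "integral_cyl T \<Omega> X = set_lebesgue_integral lebesgue ({0..T} \<times> \<Omega>) (\<lambda>(t, x). X t x)"

definition \<Phi> :: "real \<Rightarrow> real \<Rightarrow> real" where
  "\<Phi> m r = \<bar>r\<bar> powr m * sgn r"

definition \<mu> ::
    "('n::finite \<Rightarrow> 'a::euclidean_space \<Rightarrow> real) \<Rightarrow> (real \<Rightarrow> real ^ 'n) \<Rightarrow> real \<Rightarrow> 'a \<Rightarrow> real" where
  "\<mu> f z t x = - (\<Sum>k\<in>UNIV. f k x * z t $ k)"

definition space_pairing ::
    "'a::euclidean_space set \<Rightarrow> ('a \<Rightarrow> real) \<Rightarrow> (real \<Rightarrow> 'a \<Rightarrow> real) \<Rightarrow> (real \<Rightarrow> 'a \<Rightarrow> real) \<Rightarrow> real \<Rightarrow> real" where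
  "space_pairing \<Omega> g X \<eta> t = (LINT x:\<Omega>|lebesgue. g x * X t x * \<eta> t x)"

text \<open>The integrability clause makes the pairing meaningful at every time; without it, HOL would
  silently assign the value 0 to a divergent integral.\<close>
definition continuous_pairing ::
    "real \<Rightarrow> 'a::euclidean_space set \<Rightarrow> ('a \<Rightarrow> real) \<Rightarrow> (real \<Rightarrow> 'a \<Rightarrow> real) \<Rightarrow> (real \<Rightarrow> 'a \<Rightarrow> real) \<Rightarrow> bool" where
  "continuous_pairing T \<Omega> g X \<eta> \<longleftrightarrow>
    (\<forall>t\<in>{0..T}. L1 \<Omega> (\<lambda>x. g x * X t x * \<eta> t x)) \<and>
    continuous_on {0..T} (space_pairing \<Omega> g X \<eta>)"

definition very_weak_solution_transformed ::
    "real \<Rightarrow> real \<Rightarrow> 'a::euclidean_space set \<Rightarrow> ('n::finite \<Rightarrow> 'a \<Rightarrow> real) \<Rightarrow> (real \<Rightarrow> real ^ 'n)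
      \<Rightarrow> ('a \<Rightarrow> real) \<Rightarrow> (real \<Rightarrow> 'a \<Rightarrow> real) \<Rightarrow> bool" where
  "very_weak_solution_transformed m T \<Omega> f z Y0 Y \<longleftrightarrow>
    L1 \<Omega> Y0 \<and> L1_cyl T \<Omega> Y \<and>
    L1_cyl T \<Omega> (\<lambda>r x. \<Phi> m (exp (- \<mu> f z r x) * Y r x)) \<and>
    (\<forall>\<eta>. test_function 1 T \<Omega> \<eta> \<longrightarrow>
       - integral_cyl T \<Omega> (\<lambda>r x. Y r x * time_derivative T \<eta> r x)
         - (LINT x:\<Omega>|lebesgue. Y0 x * \<eta> 0 x)
       = integral_cyl T \<Omega> (\<lambda>r x. \<Phi> m (exp (- \<mu> f z r x) * Y r x) *
           laplacian (\<lambda>y. exp (\<mu> f z r y) * \<eta> r y) x))"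

definition very_weak_solution_rough ::
    "real \<Rightarrow> real \<Rightarrow> 'a::euclidean_space set \<Rightarrow> ('n::finite \<Rightarrow> 'a \<Rightarrow> real) \<Rightarrow> (real \<Rightarrow> real ^ 'n)
      \<Rightarrow> ('a \<Rightarrow> real) \<Rightarrow> (real \<Rightarrow> 'a \<Rightarrow> real) \<Rightarrow> bool" where
  "very_weak_solution_rough m T \<Omega> f z X0 X \<longleftrightarrow>
    L1 \<Omega> X0 \<and> L1_cyl T \<Omega> X \<and>
    (\<forall>k \<eta>. test_function 1 T \<Omega> \<eta> \<longrightarrow> continuous_pairing T \<Omega> (f k) X \<eta>) \<and>
    L1_cyl T \<Omega> (\<lambda>r x. \<Phi> m (X r x)) \<and>
    (\<forall>\<eta>. test_function 1 T \<Omega> \<eta> \<longrightarrow>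
       - integral_cyl T \<Omega> (\<lambda>r x. X r x * time_derivative T \<eta> r x)
         - (LINT x:\<Omega>|lebesgue. X0 x * \<eta> 0 x)
       = integral_cyl T \<Omega> (\<lambda>r x. \<Phi> m (X r x) * laplacian (\<eta> r) x)
         + (\<Sum>k\<in>UNIV. RS_integral (space_pairing \<Omega> (f k) X \<eta>) (\<lambda>r. z r $ k) 0 T))"

end

theory Submission
  imports Defs
begin

text \<open>
  Formally, the chain rule for a signal \<open>z\<close> of bounded variation turns the rough equation for \<open>X\<close>, tested
  with \<open>\<phi> = exp \<mu> * \<eta>\<close>, into the transformed equation for \<open>exp \<mu> * X\<close>, tested with \<open>\<eta>\<close>: the part
  \<open>X * \<eta> * exp \<mu> * d\<mu>\<close> of \<open>X * d\<phi>\<close> is the negative of the noise term, so that the two cancel. This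
  \<open>\<phi>\<close> is no admissible test function, since \<open>\<mu>\<close> is not differentiable in time. The proof replaces \<open>z\<close>
  in the exponential by \<open>C\<^sup>1\<close> signals \<open>w n\<close> that converge uniformly and whose variations are
  bounded by the one of \<open>z\<close> (\<open>C1_approximation_of_bounded_variation\<close>), tests the rough equation with
  \<open>exp (\<mu> f (w n)) * \<eta>\<close>, conversely the transformed equation with \<open>exp (- \<mu> f (w n)) * \<phi>\<close>, and lets
  \<open>n \<rightarrow> \<infinity>\<close>.

  The integrals over the cylinder and the initial term pass to the limit because an integrable
  function is multiplied by a uniformly convergent sequence of continuous functions. The derivative
  of the exponential leaves the integrals over \<open>[0, T]\<close> of the pairings
  \<open>\<integral> f k * X t * exp (\<mu> f (w n)) * \<eta> t\<close> against the derivative of the \<open>k\<close>-th component of \<open>w n\<close>. They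
  tend to a Riemann-Stieltjes integral against \<open>z\<close> if the pairings converge uniformly in \<open>t\<close>
  (\<open>moving_integrands_tendsto_RS_integral\<close>).

  Uniform convergence of the pairings is the delicate point, because no bound on \<open>X t\<close> uniform in \<open>t\<close>
  is given. What is given is that the pairing with every test function of class
  \<open>C\<^sup>0\<^sup>,\<^sup>2\<close> is continuous in time, and \<open>exp (\<mu> f v) * \<eta>\<close> is such a test function for
  every continuous path \<open>v\<close> of signal values. A function of time and signal value that is continuous
  in the value and along every continuous path is jointly continuous
  (\<open>joint_continuity_from_paths\<close>), hence uniformly continuous on compact sets, and this gives the
  uniform convergence.
\<close>

section \<open>Riemann-Stieltjes integrals as limits of integrals against smooth signals\<close>

text \<open>
  On each cell the sum replaces \<open>h\<close> by its value at the tag, which costs at most the oscillation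
  \<open>\<epsilon>\<close> times the variation of \<open>w\<close> on that cell. The point is that the bound sees the
  integrator only through its variation, hence is uniform over integrators with a common bound
  on the variation.
\<close>
lemma partition_sum_minus_integral_le:
  fixes h w w' :: "real \<Rightarrow> real" and t s :: "nat \<Rightarrow> real"
  assumes w: "\<And>x. x \<in> {a..b} \<Longrightarrow> (w has_vector_derivative w' x) (at x within {a..b})"
    and w'c: "continuous_on {a..b} w'" and hc: "continuous_on {a..b} h"
    and osc: "\<And>x y. x \<in> {a..b} \<Longrightarrow> y \<in> {a..b} \<Longrightarrow> \<bar>x - y\<bar> < \<delta> \<Longrightarrow> \<bar>h x - h y\<bar> \<le> \<epsilon>"
    and t0: "t 0 = a" and tn: "t n \<le> b"
    and ts: "\<forall>i<n. t i \<le> s i \<and> s i \<le> t (Suc i) \<and> t (Suc i) - t i < \<delta>"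
  shows "\<bar>(\<Sum>i<n. h (s i) * (w (t (Suc i)) - w (t i))) - integral {a..t n} (\<lambda>x. h x * w' x)\<bar>
    \<le> \<epsilon> * integral {a..t n} (\<lambda>x. \<bar>w' x\<bar>)"
  using tn ts
proof (induction n)
  case 0
  then show ?case by (simp add: t0)
next
  case (Suc n)
  have mono: "a \<le> t i" if "i \<le> Suc n" for i
    using that
  proof (induction i)
    case (Suc i)
    then show ?case using Suc.prems \<open>\<forall>i<Suc n. _\<close> by (smt (verit) less_eq_Suc_le Suc_leD)
  qed (simp add: t0)
  have step: "t n \<le> s n" "s n \<le> t (Suc n)" "t (Suc n) - t n < \<delta>" and an: "a \<le> t n"
    using Suc.prems mono by auto
  have sub: "{t n..t (Suc n)} \<subseteq> {a..b}" "{a..t (Suc n)} \<subseteq> {a..b}"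
    using an Suc.prems by auto
  have cont: "continuous_on {a..b} (\<lambda>x. h x * w' x)" "continuous_on {a..b} (\<lambda>x. \<bar>w' x\<bar>)"
    by (intro continuous_intros w'c hc)+
  have split: "integral {a..t n} g + integral {t n..t (Suc n)} g = integral {a..t (Suc n)} g"
    if "continuous_on {a..b} g" for g :: "real \<Rightarrow> real"
    using an step that sub
    by (intro Henstock_Kurzweil_Integration.integral_combine integrable_continuous_real)
      (auto intro: continuous_on_subset)
  have inc: "(w' has_integral (w (t (Suc n)) - w (t n))) {t n..t (Suc n)}"
    using step sub by (intro fundamental_theorem_of_calculus has_vector_derivative_within_subset[OF w]) auto
  have int: "(\<lambda>x. h x * w' x) integrable_on {t n..t (Suc n)}" "(\<lambda>x. \<epsilon> * \<bar>w' x\<bar>) integrable_on {t n..t (Suc n)}"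
    using cont by (auto intro!: integrable_continuous_real continuous_on_mult_left intro: continuous_on_subset[OF _ sub(1)])
  have "((\<lambda>x. h (s n) * w' x - h x * w' x) has_integral
      (h (s n) * (w (t (Suc n)) - w (t n)) - integral {t n..t (Suc n)} (\<lambda>x. h x * w' x))) {t n..t (Suc n)}"
    by (intro has_integral_diff has_integral_mult_right inc integrable_integral int)
  moreover have "norm (integral {t n..t (Suc n)} (\<lambda>x. h (s n) * w' x - h x * w' x))
      \<le> integral {t n..t (Suc n)} (\<lambda>x. \<epsilon> * \<bar>w' x\<bar>)"
  proof (rule integral_norm_bound_integral)
    show "(\<lambda>x. h (s n) * w' x - h x * w' x) integrable_on {t n..t (Suc n)}"
      using calculation by blast
    fix x assume x: "x \<in> {t n..t (Suc n)}"
    then have "\<bar>h (s n) - h x\<bar> \<le> \<epsilon>"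
      using step sub by (intro osc) auto
    then have "\<bar>h (s n) - h x\<bar> * \<bar>w' x\<bar> \<le> \<epsilon> * \<bar>w' x\<bar>"
      by (rule mult_right_mono) simp
    then show "norm (h (s n) * w' x - h x * w' x) \<le> \<epsilon> * \<bar>w' x\<bar>"
      by (simp add: abs_mult[symmetric] algebra_simps)
  qed (use int in auto)
  ultimately have "\<bar>h (s n) * (w (t (Suc n)) - w (t n)) - integral {t n..t (Suc n)} (\<lambda>x. h x * w' x)\<bar>
      \<le> \<epsilon> * integral {t n..t (Suc n)} (\<lambda>x. \<bar>w' x\<bar>)"
    by (simp add: integral_unique)
  moreover have "\<bar>(\<Sum>i<n. h (s i) * (w (t (Suc i)) - w (t i))) - integral {a..t n} (\<lambda>x. h x * w' x)\<bar>
    \<le> \<epsilon> * integral {a..t n} (\<lambda>x. \<bar>w' x\<bar>)"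
    using Suc step by auto
  ultimately show ?case
    using split[OF cont(1)] split[OF cont(2)] by (simp add: algebra_simps flip: split[OF cont(1)] split[OF cont(2)])
qed

lemma fine_partition_exists:
  fixes a b \<delta> :: real
  assumes "a \<le> b" "\<delta> > 0"
  obtains n and t :: "nat \<Rightarrow> real" where "t 0 = a" "t n = b" "\<forall>i<n. t i \<le> t (Suc i) \<and> t (Suc i) - t i < \<delta>"
proof -
  obtain n where n: "(b - a) / \<delta> < real n" using reals_Archimedean2 by blast
  then have n0: "n > 0" using assms by (cases n) (auto simp: field_simps not_less)
  show thesis
  proof
    let ?t = "\<lambda>i. a + (b - a) / n * real i"
    show "?t 0 = a" by simp
    show "?t n = b" using n0 by simp
    have "(b - a) / n < \<delta>" using n n0 assms by (simp add: field_simps)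
    moreover have "?t (Suc i) - ?t i = (b - a) / n" "0 \<le> (b - a) / n" for i
      using assms by (simp_all add: distrib_left)
    ultimately show "\<forall>i<n. ?t i \<le> ?t (Suc i) \<and> ?t (Suc i) - ?t i < \<delta>"
      by (smt (verit))
  qed
qed

lemma has_RS_integral_unique:
  assumes I: "has_RS_integral g z a b I" and J: "has_RS_integral g z a b J" and ab: "a \<le> b"
  shows "I = J"
proof (rule ccontr)
  assume "I \<noteq> J"
  then have e: "\<bar>I - J\<bar> / 2 > 0" by simp
  obtain d1 where d1: "d1 > 0" and I': "\<And>n t s. t 0 = a \<and> t n = b \<and>
       (\<forall>i<n. t i \<le> s i \<and> s i \<le> t (Suc i) \<and> t (Suc i) - t i < d1) \<Longrightarrow>
       \<bar>(\<Sum>i<n. g (s i) * (z (t (Suc i)) - z (t i))) - I\<bar> < \<bar>I - J\<bar> / 2"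
    using I e unfolding has_RS_integral_def by meson
  obtain d2 where d2: "d2 > 0" and J': "\<And>n t s. t 0 = a \<and> t n = b \<and>
       (\<forall>i<n. t i \<le> s i \<and> s i \<le> t (Suc i) \<and> t (Suc i) - t i < d2) \<Longrightarrow>
       \<bar>(\<Sum>i<n. g (s i) * (z (t (Suc i)) - z (t i))) - J\<bar> < \<bar>I - J\<bar> / 2"
    using J e unfolding has_RS_integral_def by meson
  obtain n t where "t 0 = a" "t n = b" "\<forall>i<n. t i \<le> t (Suc i) \<and> t (Suc i) - t i < min d1 d2"
    using d1 d2 by (auto intro: fine_partition_exists[OF ab, of "min d1 d2"])
  then have "\<bar>(\<Sum>i<n. g (t i) * (z (t (Suc i)) - z (t i))) - I\<bar> < \<bar>I - J\<bar> / 2"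
    "\<bar>(\<Sum>i<n. g (t i) * (z (t (Suc i)) - z (t i))) - J\<bar> < \<bar>I - J\<bar> / 2"
    using I'[of t n t] J'[of t n t] by auto
  moreover have "\<not> (\<bar>S - I\<bar> < \<bar>I - J\<bar> / 2 \<and> \<bar>S - J\<bar> < \<bar>I - J\<bar> / 2)" for S
    by (simp add: abs_if)
  ultimately show False by blast
qed

lemma RS_integral_eqI: "has_RS_integral g z a b I \<Longrightarrow> a \<le> b \<Longrightarrow> RS_integral g z a b = I"
  unfolding RS_integral_def using has_RS_integral_unique by blast

text \<open>
  For a fixed partition the sums for \<open>w n\<close> converge to the sum for \<open>z\<close>, because a sum involves
  finitely many values of the integrator. By \<open>partition_sum_minus_integral_le\<close> sum and integral
  differ, for all \<open>n\<close> at once, by an amount that is small with the mesh. Exchanging the two limits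
  gives both that the integrals converge and that their limit is the Riemann-Stieltjes integral against \<open>z\<close>, so
  that no comparison of two partitions through a common refinement is necessary.
\<close>
lemma C1_integrals_tendsto_RS_integral:
  fixes h z :: "real \<Rightarrow> real" and w w' :: "nat \<Rightarrow> real \<Rightarrow> real"
  assumes ab: "a \<le> b" and hc: "continuous_on {a..b} h"
    and w: "\<And>n x. x \<in> {a..b} \<Longrightarrow> (w n has_vector_derivative w' n x) (at x within {a..b})"
    and w'c: "\<And>n. continuous_on {a..b} (w' n)"
    and V: "\<And>n. integral {a..b} (\<lambda>x. \<bar>w' n x\<bar>) \<le> V"
    and lim: "\<And>x. x \<in> {a..b} \<Longrightarrow> (\<lambda>n. w n x) \<longlonglongrightarrow> z x"
  shows "(\<lambda>n. integral {a..b} (\<lambda>x. h x * w' n x)) \<longlonglongrightarrow> RS_integral h z a b"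
proof -
  define I where "I n = integral {a..b} (\<lambda>x. h x * w' n x)" for n
  define S where "S n t s v = (\<Sum>i<n. h (s i) * (v (t (Suc i)) - v (t i)))" for n :: nat and t s and v :: "real \<Rightarrow> real"
  define tagged where "tagged \<delta> n t s \<longleftrightarrow> t 0 = a \<and> t n = b \<and>
    (\<forall>i<n. t i \<le> s i \<and> s i \<le> t (Suc i) \<and> t (Suc i) - t i < \<delta>)" for \<delta> and n :: nat and t s :: "nat \<Rightarrow> real"
  have "0 \<le> integral {a..b} (\<lambda>x. \<bar>w' 0 x\<bar>)"
    by (intro Henstock_Kurzweil_Integration.integral_nonneg integrable_continuous_real continuous_intros w'c) auto
  then have V0: "V \<ge> 0" using V[of 0] by linarith
  \<comment> \<open>The mesh \<open>\<delta>\<close> is chosen before the index \<open>j\<close>; this uniformity drives the exchange of limits.\<close>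
  have key: "\<exists>\<delta>>0. \<forall>n t s j. tagged \<delta> n t s \<longrightarrow> \<bar>S n t s (w j) - I j\<bar> \<le> \<epsilon>" if e: "\<epsilon> > 0" for \<epsilon>
  proof -
    have "uniformly_continuous_on {a..b} h" by (intro compact_uniformly_continuous hc) simp
    moreover have "\<epsilon> / (V + 1) > 0" using e V0 by simp
    ultimately obtain \<delta> where d: "\<delta> > 0" "\<And>x y. x \<in> {a..b} \<Longrightarrow> y \<in> {a..b} \<Longrightarrow> dist x y < \<delta> \<Longrightarrow> dist (h x) (h y) < \<epsilon> / (V + 1)"
      unfolding uniformly_continuous_on_def by (metis dist_commute)
    have "\<bar>S n t s (w j) - I j\<bar> \<le> \<epsilon>" if f: "tagged \<delta> n t s" for n t s j
    proof -
      have "\<bar>S n t s (w j) - I j\<bar> \<le> \<epsilon> / (V + 1) * integral {a..b} (\<lambda>x. \<bar>w' j x\<bar>)"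
        using partition_sum_minus_integral_le[OF w w'c hc, where \<delta> = \<delta> and \<epsilon> = "\<epsilon> / (V + 1)" and t = t and n = n and s = s] d f
        by (auto simp: S_def I_def tagged_def dist_real_def less_imp_le)
      also have "\<dots> \<le> \<epsilon> / (V + 1) * (V + 1)"
        using V[of j] V0 e by (intro mult_left_mono) auto
      finally show ?thesis using V0 by simp
    qed
    then show ?thesis using d by auto
  qed
  have tagged_ex: "\<exists>n t s. tagged \<delta> n t s" if "\<delta> > 0" for \<delta>
    using fine_partition_exists[OF ab that] unfolding tagged_def by (metis order_refl)
  have Slim: "(\<lambda>j. S n t s (w j)) \<longlonglongrightarrow> S n t s z" if f: "tagged \<delta> n t s" for \<delta> n t s
  proof -
    have "a \<le> t i \<and> t i \<le> t n" if "i \<le> n" for i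
    proof -
      have "t i \<le> t j" if "i \<le> j" "j \<le> n" for i j
        using that
      proof (induction j)
        case (Suc j)
        then have "t j \<le> t (Suc j)" using f unfolding tagged_def by (meson less_eq_Suc_le order_trans)
        with Suc show ?case by (cases "i = Suc j") auto
      qed auto
      from this[of 0 i] this[of i n] show ?thesis using that f by (auto simp: tagged_def)
    qed
    then have "t i \<in> {a..b}" if "i \<le> n" for i using f that by (auto simp: tagged_def)
    then show ?thesis unfolding S_def by (intro tendsto_intros lim) auto
  qed
  have "Cauchy I"
  proof (rule metric_CauchyI)
    fix e :: real assume e: "e > 0"
    obtain \<delta> where d: "\<delta> > 0" "\<And>n t s j. tagged \<delta> n t s \<Longrightarrow> \<bar>S n t s (w j) - I j\<bar> \<le> e / 4"
      using key[of "e/4"] e by auto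
    obtain n t s where f: "tagged \<delta> n t s" using tagged_ex d by blast
    have "Cauchy (\<lambda>j. S n t s (w j))" using Slim[OF f] by (rule LIMSEQ_imp_Cauchy)
    then obtain M where M: "\<And>i j. i \<ge> M \<Longrightarrow> j \<ge> M \<Longrightarrow> dist (S n t s (w i)) (S n t s (w j)) < e / 4"
      using metric_CauchyD[of _ "e/4"] e by (metis zero_less_divide_iff zero_less_numeral)
    show "\<exists>M. \<forall>m\<ge>M. \<forall>n\<ge>M. dist (I m) (I n) < e"
    proof (intro exI[of _ M] allI impI)
      fix i j assume "i \<ge> M" "j \<ge> M"
      then have "\<bar>S n t s (w i) - S n t s (w j)\<bar> < e / 4" using M by (simp add: dist_real_def)
      with d(2)[OF f, of i] d(2)[OF f, of j] e show "dist (I i) (I j) < e"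
        unfolding dist_real_def by linarith
    qed
  qed
  then obtain J where J: "I \<longlonglongrightarrow> J" using real_Cauchy_convergent convergent_def by blast
  have RS: "has_RS_integral h z a b J"
    unfolding has_RS_integral_def
  proof (intro allI impI)
    fix e :: real assume e: "e > 0"
    obtain \<delta> where d: "\<delta> > 0" "\<And>n t s j. tagged \<delta> n t s \<Longrightarrow> \<bar>S n t s (w j) - I j\<bar> \<le> e / 2"
      using key[of "e/2"] e by auto
    have "\<bar>S n t s z - J\<bar> < e" if f: "tagged \<delta> n t s" for n t s
    proof -
      have "(\<lambda>j. \<bar>S n t s (w j) - I j\<bar>) \<longlonglongrightarrow> \<bar>S n t s z - J\<bar>"
        by (intro tendsto_intros Slim[OF f] J)
      then have "\<bar>S n t s z - J\<bar> \<le> e / 2"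
        using d(2)[OF f] by (intro LIMSEQ_le_const2) auto
      then show ?thesis using e by simp
    qed
    then show "\<exists>\<delta>>0. \<forall>n t s. t 0 = a \<and> t n = b \<and>
       (\<forall>i<n. t i \<le> s i \<and> s i \<le> t (Suc i) \<and> t (Suc i) - t i < \<delta>) \<longrightarrow>
       \<bar>(\<Sum>i<n. h (s i) * (z (t (Suc i)) - z (t i))) - J\<bar> < e"
      using d(1) unfolding tagged_def S_def by blast
  qed
  show ?thesis using RS_integral_eqI[OF RS ab] J by (simp add: I_def[abs_def])
qed

text \<open>
  Replacing \<open>H n\<close> by its limit changes every integral against \<open>w j\<close> by at most \<open>V\<close> times the
  uniform distance, for all \<open>j\<close> at once. In the diagonal \<open>j = n\<close> this gives the first claim; for
  fixed \<open>n\<close> and \<open>j \<rightarrow> \<infinity>\<close> it gives the second.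
\<close>
lemma moving_integrands_tendsto_RS_integral:
  fixes h :: "real \<Rightarrow> real" and z :: "real \<Rightarrow> real" and w w' H :: "nat \<Rightarrow> real \<Rightarrow> real"
  assumes ab: "a \<le> b"
    and w: "\<And>n x. x \<in> {a..b} \<Longrightarrow> (w n has_vector_derivative w' n x) (at x within {a..b})"
    and w'c: "\<And>n. continuous_on {a..b} (w' n)"
    and V: "\<And>n. integral {a..b} (\<lambda>x. \<bar>w' n x\<bar>) \<le> V"
    and lim: "\<And>x. x \<in> {a..b} \<Longrightarrow> (\<lambda>n. w n x) \<longlonglongrightarrow> z x"
    and Hc: "\<And>n. continuous_on {a..b} (H n)" 
    and Hlim: "uniform_limit {a..b} H h sequentially"
  shows "(\<lambda>n. integral {a..b} (\<lambda>x. H n x * w' n x)) \<longlonglongrightarrow> RS_integral h z a b"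
    and "(\<lambda>n. RS_integral (H n) z a b) \<longlonglongrightarrow> RS_integral h z a b"
proof -
  have hc: "continuous_on {a..b} h"
    using Hc by (intro uniform_limit_theorem[OF _ Hlim]) auto
  note tends = C1_integrals_tendsto_RS_integral[OF ab _ w w'c V lim]
  have "0 \<le> integral {a..b} (\<lambda>x. \<bar>w' 0 x\<bar>)"
    by (intro Henstock_Kurzweil_Integration.integral_nonneg integrable_continuous_real continuous_intros w'c) auto
  then have V0: "V \<ge> 0" using V[of 0] by linarith
  have tends_h: "(\<lambda>n. integral {a..b} (\<lambda>x. h x * w' n x)) \<longlonglongrightarrow> RS_integral h z a b"
    by (rule tends[OF hc])
  have diff: "\<bar>integral {a..b} (\<lambda>x. H n x * w' j x) - integral {a..b} (\<lambda>x. h x * w' j x)\<bar> \<le> e * V"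
    if e: "e > 0" and H: "\<And>x. x \<in> {a..b} \<Longrightarrow> dist (H n x) (h x) < e" for n j e
  proof -
    have "norm (integral {a..b} (\<lambda>x. H n x * w' j x - h x * w' j x)) \<le> integral {a..b} (\<lambda>x. e * \<bar>w' j x\<bar>)"
    proof (rule integral_norm_bound_integral)
      fix x assume "x \<in> {a..b}"
      then have "\<bar>H n x - h x\<bar> * \<bar>w' j x\<bar> \<le> e * \<bar>w' j x\<bar>"
        using H by (intro mult_right_mono) (auto simp: dist_real_def less_imp_le)
      then show "norm (H n x * w' j x - h x * w' j x) \<le> e * \<bar>w' j x\<bar>"
        by (simp add: abs_mult[symmetric] algebra_simps)
    qed (auto intro!: integrable_continuous_real continuous_intros Hc hc w'c)
    also have "\<dots> \<le> e * V" using V[of j] e by simp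
    finally show ?thesis
      by (subst (asm) Henstock_Kurzweil_Integration.integral_diff)
        (auto intro!: integrable_continuous_real continuous_intros Hc hc w'c)
  qed
  have ev: "\<forall>\<^sub>F n in sequentially. \<forall>j. \<bar>integral {a..b} (\<lambda>x. H n x * w' j x) - integral {a..b} (\<lambda>x. h x * w' j x)\<bar> \<le> e" if e: "e > 0" for e
  proof -
    have e': "e / (V + 1) > 0" using e V0 by simp
    have le: "e / (V + 1) * V \<le> e" using e V0 by (simp add: field_simps)
    show ?thesis
      using uniform_limitD[OF Hlim e'] 
      proof eventually_elim
        case (elim n)
        then show ?case using diff[OF e', of n] le by (meson order_trans)
      qed
  qed
  show "(\<lambda>n. integral {a..b} (\<lambda>x. H n x * w' n x)) \<longlonglongrightarrow> RS_integral h z a b"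
  proof (rule tendstoI)
    fix e :: real assume "e > 0"
    then have "e / 2 > 0" by simp
    from ev[OF this] tendstoD[OF tends_h this]
    show "\<forall>\<^sub>F n in sequentially. dist (integral {a..b} (\<lambda>x. H n x * w' n x)) (RS_integral h z a b) < e"
    proof eventually_elim
      case (elim n)
      then have "\<bar>integral {a..b} (\<lambda>x. H n x * w' n x) - integral {a..b} (\<lambda>x. h x * w' n x)\<bar> \<le> e / 2" by blast
      with elim show ?case unfolding dist_real_def by linarith
    qed
  qed
  show "(\<lambda>n. RS_integral (H n) z a b) \<longlonglongrightarrow> RS_integral h z a b"
  proof (rule tendstoI)
    fix e :: real assume e: "e > 0"
    then have "e / 2 > 0" by simp
    from ev[OF this]
    show "\<forall>\<^sub>F n in sequentially. dist (RS_integral (H n) z a b) (RS_integral h z a b) < e"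
    proof eventually_elim
      case (elim n)
      have "(\<lambda>j. \<bar>integral {a..b} (\<lambda>x. H n x * w' j x) - integral {a..b} (\<lambda>x. h x * w' j x)\<bar>) \<longlonglongrightarrow> 
        \<bar>RS_integral (H n) z a b - RS_integral h z a b\<bar>"
        by (intro tendsto_intros tends Hc hc)
      then have "\<bar>RS_integral (H n) z a b - RS_integral h z a b\<bar> \<le> e / 2"
        using elim by (intro LIMSEQ_le_const2) auto
      then show ?case using e by (simp add: dist_real_def)
    qed
  qed
qed

section \<open>Smooth approximation of signals of bounded variation\<close>

lemma integral_translated_blocks:
  fixes g :: "real \<Rightarrow> real"
  assumes g: "continuous_on {0..} g" and d: "\<delta> \<ge> 0"
  shows "integral {0..real N * \<delta>} g = integral {0..\<delta>} (\<lambda>s. \<Sum>j<N. g (s + real j * \<delta>))"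
proof (induction N)
  case (Suc N)
  have gi: "g integrable_on {x..y}" if "x \<ge> 0" for x y
    using that by (intro integrable_continuous_real continuous_on_subset[OF g]) auto
  have shift: "integral {0..\<delta>} (\<lambda>s. g (s + real N * \<delta>)) = integral {real N * \<delta>..real (Suc N) * \<delta>} g"
  proof -
    have "integral {0..\<delta>} (g \<circ> (+) (real N * \<delta>)) = integral {0 + real N * \<delta>..\<delta> + real N * \<delta>} g"
      by (rule integral_shift_Icc_real)
    then show ?thesis by (simp add: o_def algebra_simps)
  qed
  have gc: "continuous_on {0..\<delta>} (\<lambda>s. g (s + real j * \<delta>))" for j
    using d by (intro continuous_on_compose2[OF g] continuous_intros) auto
  have "integral {0..real (Suc N) * \<delta>} g = integral {0..real N * \<delta>} g + integral {real N * \<delta>..real (Suc N) * \<delta>} g"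
    using d by (intro Henstock_Kurzweil_Integration.integral_combine[symmetric] gi) (auto simp: algebra_simps)
  also have "\<dots> = integral {0..\<delta>} (\<lambda>s. (\<Sum>j<N. g (s + real j * \<delta>)) + g (s + real N * \<delta>))"
    by (subst Henstock_Kurzweil_Integration.integral_add)
      (auto intro!: integrable_continuous_real continuous_intros gc simp: Suc shift)
  finally show ?case by simp
qed simp

text \<open>
  The approximations are the averages of \<open>z\<close> over a window of length \<open>\<delta> n\<close> to the right, with
  \<open>z\<close> continued by a constant beyond \<open>T\<close>. Their derivatives are difference quotients of \<open>z\<close> with
  step \<open>\<delta> n\<close>. Since \<open>\<delta> n\<close> divides \<open>T\<close>, the integral of the norm of such a quotient is the average,
  over the starting point in the first cell, of the variation sums of \<open>z\<close> along a grid with step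
  \<open>\<delta> n\<close>, so that the variation of \<open>z\<close> bounds it.
\<close>
lemma C1_approximation_of_bounded_variation:
  fixes z :: "real \<Rightarrow> 'b::euclidean_space"
  assumes T: "T > 0" and zc: "continuous_on {0..T} z"
    and bv: "bounded_variation_on_interval 0 T z"
  obtains w w' V where
    "\<And>n t. t \<in> {0..T} \<Longrightarrow> (w n has_vector_derivative w' n t) (at t within {0..T})"
    "\<And>n. continuous_on {0..T} (w n)"
    "\<And>n::nat. continuous_on {0..T} (w' n)"
    "\<And>n. integral {0..T} (\<lambda>t. norm (w' n t)) \<le> V"
    "uniform_limit {0..T} w z sequentially"
proof -
  obtain V where V: "\<And>n (t :: nat \<Rightarrow> real). t 0 = 0 \<Longrightarrow> t n = T \<Longrightarrow> (\<And>i. i<n \<Longrightarrow> t i \<le> t (Suc i)) \<Longrightarrow>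
       (\<Sum>i<n. norm (z (t (Suc i)) - z (t i))) \<le> V"
    using bv unfolding bounded_variation_on_interval_def by metis
  define y where "y t = z (min T t)" for t
  have yz: "y t = z t" if "t \<in> {0..T}" for t using that by (simp add: y_def)
  have yc: "continuous_on {0..} y"
    unfolding y_def using T by (intro continuous_on_compose2[OF zc] continuous_intros) auto
  have yi: "y integrable_on {a..b}" if "a \<ge> 0" for a b
    using that by (intro integrable_continuous_real continuous_on_subset[OF yc]) auto
  define \<delta> where "\<delta> n = T / real (Suc n)" for n
  have d0: "\<delta> n > 0" for n using T by (simp add: \<delta>_def)
  define w where "w n t = (1 / \<delta> n) *\<^sub>R (integral {0..t + \<delta> n} y - integral {0..t} y)" for n t
  define w' where "w' n t = (1 / \<delta> n) *\<^sub>R (y (t + \<delta> n) - y t)" for n t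
  have der: "(w n has_vector_derivative w' n t) (at t within {0..T})" if t: "t \<in> {0..T}" for n t
  proof -
    have *: "((\<lambda>u. integral {0..u} y) has_vector_derivative y s) (at s within {0..T + \<delta> n})" if "s \<in> {0..T + \<delta> n}" for s
      using that by (intro integral_has_vector_derivative continuous_on_subset[OF yc]) auto
    have "((\<lambda>u. integral {0..u} y) has_vector_derivative y t) (at t within {0..T})"
      by (rule has_vector_derivative_within_subset[OF *]) (use t d0[of n] in auto)
    moreover have "(((\<lambda>u. integral {0..u} y) \<circ> (\<lambda>t. t + \<delta> n)) has_vector_derivative 1 *\<^sub>R y (t + \<delta> n)) (at t within {0..T})"
    proof (rule vector_diff_chain_within)
      show "((\<lambda>t. t + \<delta> n) has_vector_derivative 1) (at t within {0..T})"
        by (auto intro!: derivative_eq_intros)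
      show "((\<lambda>u. integral {0..u} y) has_vector_derivative y (t + \<delta> n)) (at (t + \<delta> n) within (\<lambda>t. t + \<delta> n) ` {0..T})"
        by (rule has_vector_derivative_within_subset[OF *]) (use t d0[of n] in auto)
    qed
    ultimately have "((\<lambda>t. ((\<lambda>u. integral {0..u} y) \<circ> (\<lambda>t. t + \<delta> n)) t - integral {0..t} y)
        has_vector_derivative 1 *\<^sub>R y (t + \<delta> n) - y t) (at t within {0..T})"
      by (intro has_vector_derivative_diff)
    from bounded_linear.has_vector_derivative[OF bounded_linear_scaleR_right this, of "1 / \<delta> n"]
    show ?thesis unfolding w_def w'_def o_def by simp
  qed
  have w'c: "continuous_on {0..T} (w' n)" for n
    unfolding w'_def using d0[of n]
    by (intro continuous_intros continuous_on_compose2[OF yc]) auto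
  have wc: "continuous_on {0..T} (w n)" for n
    using der has_vector_derivative_continuous continuous_on_eq_continuous_within by blast
  have le: "integral {0..T} (\<lambda>t. norm (w' n t)) \<le> V" for n
  proof -
    define g where "g t = norm (y (t + \<delta> n) - y t)" for t
    have gc: "continuous_on {0..} g"
      unfolding g_def using d0[of n] by (intro continuous_intros continuous_on_compose2[OF yc]) auto
    have bound: "(\<Sum>j<Suc n. g (s + real j * \<delta> n)) \<le> V" if s: "s \<in> {0..\<delta> n}" for s
    proof -
      \<comment> \<open>The grid that starts at \<open>s\<close>, completed by the end points \<open>0\<close> and \<open>T\<close>.\<close>
      define \<tau> where "\<tau> i = (case i of 0 \<Rightarrow> 0 | Suc j \<Rightarrow> min T (s + real j * \<delta> n))" for i
      have T_eq: "real (Suc n) * \<delta> n = T" by (simp add: \<delta>_def)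
      have "(\<Sum>i<Suc (Suc n). norm (z (\<tau> (Suc i)) - z (\<tau> i))) \<le> V"
      proof (rule V)
        show "\<tau> 0 = 0" by (simp add: \<tau>_def)
        show "\<tau> (Suc (Suc n)) = T" using s T_eq by (simp add: \<tau>_def)
        fix i show "\<tau> i \<le> \<tau> (Suc i)"
          using s T d0[of n] by (cases i) (auto simp: \<tau>_def algebra_simps)
      qed
      moreover have "(\<Sum>i<Suc (Suc n). norm (z (\<tau> (Suc i)) - z (\<tau> i)))
          = norm (z (\<tau> 1) - z (\<tau> 0)) + (\<Sum>j<Suc n. g (s + real j * \<delta> n))"
        by (subst sum.lessThan_Suc_shift) (simp add: \<tau>_def g_def y_def algebra_simps)
      ultimately show ?thesis by (smt (verit) norm_ge_zero)
    qed
    have "integral {0..T} g = integral {0..\<delta> n} (\<lambda>s. \<Sum>j<Suc n. g (s + real j * \<delta> n))"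
      using integral_translated_blocks[OF gc, of "\<delta> n" "Suc n"] d0[of n] by (simp add: \<delta>_def)
    also have "\<dots> \<le> integral {0..\<delta> n} (\<lambda>s. V)"
    proof (rule integral_le)
      show "(\<lambda>s. \<Sum>j<Suc n. g (s + real j * \<delta> n)) integrable_on {0..\<delta> n}"
        using d0[of n] by (intro integrable_continuous_real continuous_intros continuous_on_compose2[OF gc]) auto
    qed (use bound in auto)
    also have "\<dots> = \<delta> n * V" using d0[of n] by simp
    finally have "integral {0..T} g \<le> \<delta> n * V" .
    moreover have "integral {0..T} (\<lambda>t. norm (w' n t)) = integral {0..T} g / \<delta> n"
      unfolding g_def using d0[of n] by (simp add: w'_def)
    ultimately show ?thesis using d0[of n] by (simp add: pos_divide_le_eq mult.commute)
  qed
  have "uniform_limit {0..T} w z sequentially"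
    unfolding uniform_limit_sequentially_iff
  proof (intro allI impI)
    fix e :: real assume e: "e > 0"
    have "uniformly_continuous_on {0..2*T} y"
      by (intro compact_uniformly_continuous continuous_on_subset[OF yc]) auto
    then obtain d where d: "d > 0" "\<And>s t. s \<in> {0..2*T} \<Longrightarrow> t \<in> {0..2*T} \<Longrightarrow> dist s t < d \<Longrightarrow> dist (y s) (y t) < e / 2"
      using e unfolding uniformly_continuous_on_def by (metis half_gt_zero)
    obtain N where N: "T / d < real N" using reals_Archimedean2 by blast
    have "dist (w n t) (z t) < e" if n: "n \<ge> N" and t: "t \<in> {0..T}" for n t
    proof -
      have "T / d < real (Suc n)" using n N by simp
      then have dn: "\<delta> n < d" using d T by (simp add: \<delta>_def field_simps)
      have "\<delta> n \<le> T" unfolding \<delta>_def using T by (simp add: field_simps)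
      have "integral {0..t + \<delta> n} y - integral {0..t} y = integral {t..t + \<delta> n} y"
        using Henstock_Kurzweil_Integration.integral_combine[of 0 t "t + \<delta> n" y] yi t d0[of n] by (simp add: algebra_simps)
      then have i: "((\<lambda>s. y s - z t) has_integral (integral {0..t + \<delta> n} y - integral {0..t} y) - \<delta> n *\<^sub>R z t) {t..t + \<delta> n}"
        using has_integral_const_real[of "z t" t "t + \<delta> n"] t d0[of n]
        by (intro has_integral_diff) (auto intro!: integrable_integral yi)
      have "norm ((integral {0..t + \<delta> n} y - integral {0..t} y) - \<delta> n *\<^sub>R z t) \<le> e / 2 * Henstock_Kurzweil_Integration.content {t..t + \<delta> n}"
      proof (rule has_integral_bound_real[OF _ finite.emptyI i])
        fix s assume "s \<in> {t..t + \<delta> n} - {}"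
        then have "dist (y s) (y t) < e / 2"
          using t \<open>\<delta> n \<le> T\<close> dn by (intro d) (auto simp: dist_real_def)
        then show "norm (y s - z t) \<le> e / 2" using yz[OF t] by (simp add: dist_norm)
      qed (use e in auto)
      then have "norm ((integral {0..t + \<delta> n} y - integral {0..t} y) - \<delta> n *\<^sub>R z t) \<le> e / 2 * \<delta> n"
        using d0[of n] by simp
      moreover have "w n t - z t = (1 / \<delta> n) *\<^sub>R ((integral {0..t + \<delta> n} y - integral {0..t} y) - \<delta> n *\<^sub>R z t)"
        using d0[of n] by (simp add: w_def algebra_simps)
      ultimately have "norm (w n t - z t) \<le> (1 / \<delta> n) * (e / 2 * \<delta> n)"
        using d0[of n] by (simp add: pos_divide_le_eq)
      then have "norm (w n t - z t) \<le> e / 2" using d0[of n] by simp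
      then show ?thesis using e by (simp add: dist_norm)
    qed
    then show "\<exists>N. \<forall>n\<ge>N. \<forall>x\<in>{0..T}. dist (w n x) (z x) < e" by blast
  qed
  with that der wc w'c le show thesis by blast
qed

section \<open>Joint continuity\<close>

text \<open>
  If joint continuity fails at \<open>(t, w)\<close>, there are bad points arbitrarily close to \<open>(t, w)\<close>, and by
  separate continuity their first components differ from \<open>t\<close>. A sequence of bad points that
  converges to \<open>(t, w)\<close> and whose times are pairwise distinct lies on the graph of a continuous path
  through \<open>(t, w)\<close>, and along this path \<open>G\<close> would be discontinuous. The lemma replaces an application
  of the uniform boundedness principle to the functionals \<open>G t\<close>.
\<close>
lemma joint_continuity_from_paths:
  fixes G :: "real \<Rightarrow> 'b::euclidean_space \<Rightarrow> real"
  assumes sep: "\<And>t. t \<in> {a..b} \<Longrightarrow> continuous_on UNIV (G t)"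
    and path: "\<And>v. continuous_on {a..b} v \<Longrightarrow> continuous_on {a..b} (\<lambda>t. G t (v t))"
  shows "continuous_on ({a..b} \<times> UNIV) (\<lambda>(t, w). G t w)"
  unfolding continuous_on_iff
proof (intro ballI allI impI, rule ccontr)
  fix p0 :: "real \<times> 'b" and e :: real
  assume p0: "p0 \<in> {a..b} \<times> UNIV" and e: "e > 0"
    and neg: "\<not> (\<exists>d>0. \<forall>q\<in>{a..b} \<times> UNIV. dist q p0 < d \<longrightarrow>
      dist (case q of (t, w) \<Rightarrow> G t w) (case p0 of (t, w) \<Rightarrow> G t w) < e)"
  obtain t w where p0_eq: "p0 = (t, w)" by (cases p0)
  have t: "t \<in> {a..b}" using p0 p0_eq by simp
  have bad: "\<exists>s v. s \<in> {a..b} \<and> dist (s, v) (t, w) < d \<and> \<bar>G s v - G t w\<bar> \<ge> e" if "d > 0" for d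
  proof -
    have "\<exists>q\<in>{a..b} \<times> UNIV. dist q p0 < d \<and> \<not> dist (case q of (t, w) \<Rightarrow> G t w) (case p0 of (t, w) \<Rightarrow> G t w) < e"
      using neg that by blast
    then show ?thesis by (auto simp: p0_eq dist_real_def not_less)
  qed
  define B where "B = {p. fst p \<in> {a..b} \<and> fst p \<noteq> t \<and> \<bar>G (fst p) (snd p) - G t w\<bar> \<ge> e}"
  obtain \<rho> where \<rho>: "\<rho> > 0" "\<And>v. dist v w < \<rho> \<Longrightarrow> \<bar>G t v - G t w\<bar> < e"
    using sep[OF t] e unfolding continuous_on_iff dist_real_def by (metis UNIV_I)
  have near: "\<exists>p\<in>B. dist p (t, w) < d" if d: "d > 0" for d
  proof -
    obtain s v where sv: "s \<in> {a..b}" "dist (s, v) (t, w) < d" "dist (s, v) (t, w) < \<rho>" "\<bar>G s v - G t w\<bar> \<ge> e"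
      using bad[of "min d \<rho>"] d \<rho>(1) by (metis min_less_iff_conj)
    have "dist v w < \<rho>" using sv(3) dist_snd_le[of "(s, v)" "(t, w)"] by simp
    then have "s \<noteq> t" using \<rho>(2)[of v] sv(4) by auto
    with sv show ?thesis by (intro bexI[of _ "(s, v)"]) (auto simp: B_def)
  qed
  \<comment> \<open>The distances of the times to \<open>t\<close> decrease strictly, which makes the times distinct.\<close>
  have "\<exists>p. \<forall>n. (p n \<in> B \<and> dist (p n) (t, w) < 1 / real (Suc n)) \<and> \<bar>fst (p (Suc n)) - t\<bar> < \<bar>fst (p n) - t\<bar>"
  proof (rule dependent_nat_choice)
    show "\<exists>p. p \<in> B \<and> dist p (t, w) < 1 / real (Suc 0)" using near[of 1] by auto
    fix p n assume "p \<in> B \<and> dist p (t, w) < 1 / real (Suc n)"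
    then have "min \<bar>fst p - t\<bar> (1 / real (Suc (Suc n))) > 0" by (auto simp: B_def)
    then obtain q where "q \<in> B" "dist q (t, w) < min \<bar>fst p - t\<bar> (1 / real (Suc (Suc n)))"
      using near by blast
    then show "\<exists>q. (q \<in> B \<and> dist q (t, w) < 1 / real (Suc (Suc n))) \<and> \<bar>fst q - t\<bar> < \<bar>fst p - t\<bar>"
      using dist_fst_le[of q "(t, w)"] by (intro exI[of _ q]) (auto simp: dist_real_def)
  qed
  then obtain p where p: "\<And>n. p n \<in> B" "\<And>n. dist (p n) (t, w) < 1 / real (Suc n)"
    and dec: "\<And>n. \<bar>fst (p (Suc n)) - t\<bar> < \<bar>fst (p n) - t\<bar>" by blast
  have plim: "p \<longlonglongrightarrow> (t, w)"
  proof (rule tendstoI)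
    fix r :: real assume "r > 0"
    from order_tendstoD(2)[OF LIMSEQ_inverse_real_of_nat this]
    show "\<forall>\<^sub>F n in sequentially. dist (p n) (t, w) < r"
      by eventually_elim (metis inverse_eq_divide less_trans p(2))
  qed
  have "strict_mono (\<lambda>n. - \<bar>fst (p n) - t\<bar>)" using dec by (simp add: strict_mono_Suc_iff)
  then have pinj: "fst (p m) = fst (p n) \<longleftrightarrow> m = n" for m n
    by (metis strict_mono_eq)
  have pt: "fst (p n) \<noteq> t" for n using p(1) by (auto simp: B_def)
  define K where "K = insert (t, w) (range p)"
  have K: "compact K" unfolding K_def by (rule compact_sequence_with_limit[OF plim])
  have injK: "inj_on fst K" using pinj pt unfolding K_def inj_on_def by (metis fst_conv image_iff insert_iff)
  \<comment> \<open>The projection to the time axis is a homeomorphism on the compact set \<open>K\<close>, so \<open>K\<close> is the graph of a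
    continuous function on a closed set of times, which extends to the whole interval.\<close>
  define \<iota> where "\<iota> = inv_into K fst"
  have \<iota>: "\<iota> (fst q) = q" if "q \<in> K" for q using that injK by (simp add: \<iota>_def)
  have \<iota>c: "continuous_on (fst ` K) \<iota>"
    by (rule continuous_on_inv[OF _ K]) (auto intro: continuous_intros \<iota>)
  have "compact (fst ` K)" by (intro compact_continuous_image K continuous_intros)
  moreover have sub: "fst ` K \<subseteq> {a..b}" using p(1) t by (auto simp: K_def B_def)
  ultimately have "closedin (top_of_set {a..b}) (fst ` K)"
    by (auto intro: closed_subset compact_imp_closed)
  then obtain v where v: "continuous_on {a..b} v" "\<And>x. x \<in> fst ` K \<Longrightarrow> v x = snd (\<iota> x)"
    by (rule Dugundji[of "UNIV :: 'b set" "{a..b}" "fst ` K" "\<lambda>x. snd (\<iota> x)", rotated 2])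
      (auto intro!: continuous_intros \<iota>c)
  have vp: "v (fst (p n)) = snd (p n)" for n using v(2)[of "fst (p n)"] \<iota>[of "p n"] by (auto simp: K_def)
  have vt: "v t = w" using v(2)[of t] \<iota>[of "(t, w)"] by (auto simp: K_def image_iff)
  have "(\<lambda>n. G (fst (p n)) (v (fst (p n)))) \<longlonglongrightarrow> G t (v t)"
    using tendsto_fst[OF plim] p(1) t
    by (intro continuous_on_tendsto_compose[OF path[OF v(1)]]) (auto simp: B_def)
  then have "(\<lambda>n. \<bar>G (fst (p n)) (snd (p n)) - G t w\<bar>) \<longlonglongrightarrow> \<bar>G t w - G t w\<bar>"
    unfolding vp vt by (intro tendsto_intros)
  then have "e \<le> \<bar>G t w - G t w\<bar>" using p(1) by (intro LIMSEQ_le_const) (auto simp: B_def)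
  with e show False by simp
qed

lemma uniform_limit_compose_jointly_continuous:
  fixes G :: "'p::metric_space \<Rightarrow> 'b::euclidean_space \<Rightarrow> real"
  assumes K: "compact K" and G: "continuous_on (K \<times> UNIV) (\<lambda>(p, w). G p w)"
    and v: "uniform_limit K vn v sequentially" and vc: "continuous_on K v"
  shows "uniform_limit K (\<lambda>n p. G p (vn n p)) (\<lambda>p. G p (v p)) sequentially"
proof -
  have "bounded (v ` K)" by (intro compact_imp_bounded compact_continuous_image vc K)
  then obtain R where R: "\<And>p. p \<in> K \<Longrightarrow> norm (v p) \<le> R" unfolding bounded_iff by (metis imageI)
  have u: "uniformly_continuous_on (K \<times> cball 0 (R + 1)) (\<lambda>(p, w). G p w)"
    by (intro compact_uniformly_continuous continuous_on_subset[OF G] compact_Times K) auto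
  show ?thesis
    unfolding uniform_limit_iff
  proof (intro allI impI)
    fix e :: real assume e: "e > 0"
    obtain d where d: "d > 0" "\<And>p q. p \<in> K \<times> cball 0 (R + 1) \<Longrightarrow> q \<in> K \<times> cball 0 (R + 1) \<Longrightarrow>
        dist q p < d \<Longrightarrow> dist ((\<lambda>(t, w). G t w) q) ((\<lambda>(t, w). G t w) p) < e"
      using u e unfolding uniformly_continuous_on_def by metis
    have "min 1 d > 0" using d by simp
    from uniform_limitD[OF v this]
    show "\<forall>\<^sub>F n in sequentially. \<forall>p\<in>K. dist (G p (vn n p)) (G p (v p)) < e"
    proof eventually_elim
      case (elim n)
      show ?case
      proof
        fix p assume p: "p \<in> K"
        then have "dist (vn n p) (v p) < 1" "dist (vn n p) (v p) < d" using elim by auto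
        moreover have "norm (vn n p) \<le> R + 1"
          using calculation R[OF p] norm_triangle_sub[of "vn n p" "v p"] by (simp add: dist_norm)
        ultimately show "dist (G p (vn n p)) (G p (v p)) < e"
          using d(2)[of "(p, v p)" "(p, vn n p)"] p R[OF p] by (simp add: dist_Pair_Pair)
      qed
    qed
  qed
qed

section \<open>Integrals of products and over cylinders\<close>

lemma set_integrable_mult_continuous:
  fixes u g :: "'p::euclidean_space \<Rightarrow> real"
  assumes u: "set_integrable lebesgue S u" and S: "S \<in> sets borel" "S \<subseteq> K" and K: "compact K"
    and g: "continuous_on K g"
  shows "set_integrable lebesgue S (\<lambda>x. u x * g x)"
proof -
  have "bounded (g ` K)" by (intro compact_imp_bounded compact_continuous_image g K)
  then obtain B where B: "\<And>x. x \<in> K \<Longrightarrow> \<bar>g x\<bar> \<le> B" unfolding bounded_iff by (metis imageI real_norm_def)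
  have "(\<lambda>x. indicator S x *\<^sub>R g x) \<in> borel_measurable borel"
    using S g by (intro borel_measurable_continuous_on_indicator continuous_on_subset[OF g]) auto
  then have gm: "(\<lambda>x. indicator S x *\<^sub>R g x) \<in> borel_measurable lebesgue"
    by (simp add: measurable_completion)
  have ui: "integrable lebesgue (\<lambda>x. indicator S x *\<^sub>R u x)" using u by (simp add: set_integrable_def)
  have "integrable lebesgue (\<lambda>x. (indicator S x *\<^sub>R u x) * (indicator S x *\<^sub>R g x))"
  proof (rule Bochner_Integration.integrable_bound)
    show "integrable lebesgue (\<lambda>x. B * (indicator S x *\<^sub>R u x))" using ui by simp
    show "(\<lambda>x. (indicator S x *\<^sub>R u x) * (indicator S x *\<^sub>R g x)) \<in> borel_measurable lebesgue"
      by (intro borel_measurable_times gm borel_measurable_integrable[OF ui])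
    show "AE x in lebesgue. norm ((indicator S x *\<^sub>R u x) * (indicator S x *\<^sub>R g x)) \<le> norm (B * (indicator S x *\<^sub>R u x))"
    proof (intro AE_I2)
      fix x
      have "\<bar>u x\<bar> * \<bar>g x\<bar> \<le> \<bar>u x\<bar> * \<bar>B\<bar>" if "x \<in> S"
        using B[of x] that S by (intro mult_left_mono) auto
      then show "norm ((indicator S x *\<^sub>R u x) * (indicator S x *\<^sub>R g x)) \<le> norm (B * (indicator S x *\<^sub>R u x))"
        by (auto simp: abs_mult indicator_def mult.commute)
    qed
  qed
  moreover have "(\<lambda>x. (indicator S x *\<^sub>R u x) * (indicator S x *\<^sub>R g x)) = (\<lambda>x. indicator S x *\<^sub>R (u x * g x))"
    by (auto simp: indicator_def)
  ultimately show ?thesis by (simp add: set_integrable_def)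
qed

lemma set_integral_mult_tendsto:
  fixes u :: "'p::euclidean_space \<Rightarrow> real" and g :: "'p \<Rightarrow> real"
  assumes u: "set_integrable lebesgue S u" and S: "S \<in> sets borel" "S \<subseteq> K" and K: "compact K"
    and gn: "\<And>n. continuous_on K (gn n)" and lim: "uniform_limit K gn g sequentially"
  shows "(\<lambda>n. LINT x:S|lebesgue. u x * gn n x) \<longlonglongrightarrow> (LINT x:S|lebesgue. u x * g x)"
proof (rule tendstoI)
  fix e :: real assume e: "e > 0"
  define U where "U = (LINT x:S|lebesgue. \<bar>u x\<bar>)"
  have ua: "set_integrable lebesgue S (\<lambda>x. \<bar>u x\<bar>)"
    using u by (rule set_integrable_abs)
  have U: "U \<ge> 0" unfolding U_def set_lebesgue_integral_def by (intro integral_nonneg_AE) auto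
  define r where "r = e / (U + 1)"
  have r: "r > 0" and rU: "r * U < e" using e U by (auto simp: r_def field_simps)
  have gc: "continuous_on K g" using gn by (intro uniform_limit_theorem[OF _ lim]) auto
  show "\<forall>\<^sub>F n in sequentially. dist (LINT x:S|lebesgue. u x * gn n x) (LINT x:S|lebesgue. u x * g x) < e"
    using uniform_limitD[OF lim r]
  proof eventually_elim
    case (elim n)
    have int: "set_integrable lebesgue S (\<lambda>x. u x * gn n x)" "set_integrable lebesgue S (\<lambda>x. u x * g x)"
      by (intro set_integrable_mult_continuous[OF u S K] gn gc)+
    have "(LINT x:S|lebesgue. u x * gn n x) - (LINT x:S|lebesgue. u x * g x) = (LINT x:S|lebesgue. u x * gn n x - u x * g x)"
      using int by (rule set_integral_diff(2)[symmetric])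
    moreover have "norm (LINT x:S|lebesgue. u x * gn n x - u x * g x) \<le> (LINT x:S|lebesgue. r * \<bar>u x\<bar>)"
      unfolding set_lebesgue_integral_def
    proof (rule Bochner_Integration.integral_norm_bound_integral)
      show "integrable lebesgue (\<lambda>x. indicator S x *\<^sub>R (u x * gn n x - u x * g x))"
        using set_integral_diff(1)[OF int] by (simp add: set_integrable_def)
      show "integrable lebesgue (\<lambda>x. indicator S x *\<^sub>R (r * \<bar>u x\<bar>))"
        using set_integrable_mult_right[of r lebesgue S "\<lambda>x. \<bar>u x\<bar>"] ua by (simp add: set_integrable_def)
      fix x
      have "\<bar>u x\<bar> * \<bar>gn n x - g x\<bar> \<le> \<bar>u x\<bar> * r" if "x \<in> S"
        using elim that S by (intro mult_left_mono) (auto simp: dist_real_def less_imp_le)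
      then show "norm (indicator S x *\<^sub>R (u x * gn n x - u x * g x)) \<le> indicator S x *\<^sub>R (r * \<bar>u x\<bar>)"
        by (auto simp: indicator_def mult.commute abs_mult[symmetric] right_diff_distrib)
    qed
    moreover have "(LINT x:S|lebesgue. r * \<bar>u x\<bar>) = r * U"
      unfolding U_def by (rule set_integral_mult_right)
    ultimately show ?case using rU by (simp only: dist_real_def real_norm_def)
  qed
qed

text \<open>
  Fubini's theorem for Lebesgue measurable integrands, which need not be measurable for the product
  of the \<open>\<sigma>\<close>-algebras: the integrand agrees almost everywhere with a Borel function, hence so do almost
  all of its sections.
\<close>
lemma integral_cyl_eq_iterated:
  fixes \<Omega> :: "'a::euclidean_space set"
  assumes \<Omega>: "open \<Omega>" and u: "L1_cyl T \<Omega> u" and ut: "\<And>t. t \<in> {0..T} \<Longrightarrow> L1 \<Omega> (u t)"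
    and g: "continuous_on {0..T} g" and gt: "\<And>t. t \<in> {0..T} \<Longrightarrow> g t = (LINT x:\<Omega>|lebesgue. u t x)"
  shows "integral_cyl T \<Omega> u = integral {0..T} g"
proof -
  define h where "h p = indicator ({0..T} \<times> \<Omega>) p *\<^sub>R u (fst p) (snd p)" for p :: "real \<times> 'a"
  have hi: "integrable lebesgue h" using u by (simp add: h_def[abs_def] L1_cyl_def set_integrable_def case_prod_unfold)
  obtain h' where h': "h' \<in> borel_measurable lborel" and eq: "AE p in lborel. h p = h' p"
    using completion_ex_borel_measurable_real[OF borel_measurable_integrable[OF hi]] by blast
  have h'c: "h' \<in> borel_measurable lebesgue" using h' by (simp add: measurable_completion)
  have "integrable lebesgue h'"
    using integrable_cong_AE[THEN iffD1, OF borel_measurable_integrable[OF hi] h'c AE_completion[OF eq] hi] .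
  then have h'i: "integrable (lborel \<Otimes>\<^sub>M lborel) h'" using h' by (simp add: integrable_completion lborel_prod)
  have "AE t in lborel. AE x in lborel. h (t, x) = h' (t, x)"
    by (rule lborel_pair.AE_pair) (use eq in \<open>simp only: lborel_prod\<close>)
  then have inner: "AE t in lborel. (\<integral>x. h' (t, x) \<partial>lborel) = indicator {0..T} t *\<^sub>R g t"
  proof eventually_elim
    case (elim t)
    have m': "(\<lambda>x. h' (t, x)) \<in> borel_measurable lborel" using h' by measurable
    have m'c: "(\<lambda>x. h' (t, x)) \<in> borel_measurable lebesgue" using m' by (simp add: measurable_completion)
    have hsec: "h (t, x) = indicator {0..T} t *\<^sub>R (indicator \<Omega> x *\<^sub>R u t x)" for x
      by (simp add: h_def indicator_def)
    have m: "(\<lambda>x. h (t, x)) \<in> borel_measurable lebesgue"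
    proof (cases "t \<in> {0..T}")
      case True
      then show ?thesis using borel_measurable_integrable[OF ut[OF True, unfolded L1_def set_integrable_def]] hsec by simp
    qed (simp add: hsec)
    have "(\<integral>x. h' (t, x) \<partial>lborel) = (\<integral>x. h' (t, x) \<partial>lebesgue)" using m' by (simp add: integral_completion)
    also have "\<dots> = (\<integral>x. h (t, x) \<partial>lebesgue)"
      by (rule integral_cong_AE[symmetric, OF m m'c AE_completion[OF elim]])
    also have "\<dots> = indicator {0..T} t *\<^sub>R g t"
      by (cases "t \<in> {0..T}") (auto simp: hsec gt set_lebesgue_integral_def)
    finally show ?case .
  qed
  have "integral_cyl T \<Omega> u = integral\<^sup>L lebesgue h"
    by (simp add: integral_cyl_def set_lebesgue_integral_def h_def[abs_def] case_prod_unfold)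
  also have "\<dots> = integral\<^sup>L lebesgue h'"
    by (rule integral_cong_AE[OF borel_measurable_integrable[OF hi] h'c AE_completion[OF eq]])
  also have "\<dots> = integral\<^sup>L (lborel \<Otimes>\<^sub>M lborel) h'" using h' by (simp add: integral_completion lborel_prod)
  also have "\<dots> = (\<integral>t. (\<integral>x. h' (t, x) \<partial>lborel) \<partial>lborel)" by (rule lborel_pair.integral_fst'[OF h'i, symmetric])
  also have "\<dots> = (\<integral>t. indicator {0..T} t *\<^sub>R g t \<partial>lborel)"
  proof (rule integral_cong_AE[OF _ _ inner])
    show "(\<lambda>t. \<integral>x. h' (t, x) \<partial>lborel) \<in> borel_measurable lborel"
      by (rule borel_measurable_integrable[OF lborel_pair.integrable_fst'[OF h'i]])
    show "(\<lambda>t. indicator {0..T} t *\<^sub>R g t) \<in> borel_measurable lborel"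
      using borel_measurable_continuous_on_indicator[OF _ g] by simp
  qed
  also have "\<dots> = integral {0..T} g"
    using set_borel_integral_eq_integral(2)[of "{0..T}" g] borel_integrable_atLeastAtMost'[OF g]
    by (simp add: set_lebesgue_integral_def)
  finally show ?thesis .
qed

section \<open>Test functions multiplied by the exponential\<close>

text \<open>
  For \<open>bs = []\<close> this is the exponent \<open>\<mu>\<close> at a frozen value \<open>w\<close> of the signal, and in general its
  derivative in the directions \<open>bs\<close>, where \<open>F k\<close> is the derivative family of the coefficient
  \<open>f k\<close>.
\<close>
definition linear_exponent :: "('n::finite \<Rightarrow> 'a list \<Rightarrow> 'a \<Rightarrow> real) \<Rightarrow> 'a list \<Rightarrow> 'a \<Rightarrow> real ^ 'n \<Rightarrow> real" where
  "linear_exponent F bs x w = - (\<Sum>k\<in>UNIV. F k bs x * w $ k)"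

text \<open>
  The Leibniz formulas for the derivatives of order at most two of \<open>exp \<mu>\<close> times a function with the
  derivative family \<open>D\<close>. The signal value is a separate argument: the formulas are then jointly
  continuous in space-time point and signal value, which turns uniform convergence of signals into
  uniform convergence of the derivatives.
\<close>
fun twisted :: "('n::finite \<Rightarrow> 'a list \<Rightarrow> 'a \<Rightarrow> real) \<Rightarrow> ('a list \<Rightarrow> real \<Rightarrow> 'a \<Rightarrow> real) \<Rightarrow>
    'a list \<Rightarrow> real \<times> 'a \<Rightarrow> real ^ 'n \<Rightarrow> real" where
  "twisted F D [] (t, x) w = exp (linear_exponent F [] x w) * D [] t x"
| "twisted F D [b] (t, x) w = exp (linear_exponent F [] x w) *
     (D [b] t x + linear_exponent F [b] x w * D [] t x)"
| "twisted F D (c # b # bs) (t, x) w = exp (linear_exponent F [] x w) *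
     (D [c, b] t x + linear_exponent F [c] x w * D [b] t x + linear_exponent F [b] x w * D [c] t x +
      (linear_exponent F [c, b] x w + linear_exponent F [c] x w * linear_exponent F [b] x w) * D [] t x)"

lemma smooth_upto_family:
  fixes f :: "'n::finite \<Rightarrow> 'a::euclidean_space \<Rightarrow> real"
  assumes "\<And>k. smooth_upto S C (f k)"
  obtains F where "\<And>k. F k [] = f k"
    "\<And>k bs. set bs \<subseteq> Basis \<Longrightarrow> continuous_on C (F k bs)"
    "\<And>k bs b x. set bs \<subseteq> Basis \<Longrightarrow> b \<in> Basis \<Longrightarrow> x \<in> S \<Longrightarrow>
       ((\<lambda>h. F k bs (x + h *\<^sub>R b)) has_real_derivative F k (b # bs) x) (at 0)"
proof -
  have "\<forall>k. \<exists>D. D [] = f k \<and>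
      (\<forall>bs. set bs \<subseteq> Basis \<longrightarrow> continuous_on C (D bs)) \<and>
      (\<forall>bs. \<forall>b\<in>Basis. \<forall>x\<in>S. set bs \<subseteq> Basis \<longrightarrow>
         ((\<lambda>h. D bs (x + h *\<^sub>R b)) has_real_derivative D (b # bs) x) (at 0))"
    using assms unfolding smooth_upto_def by blast
  then obtain F where F: "\<forall>k. F k [] = f k \<and>
      (\<forall>bs. set bs \<subseteq> Basis \<longrightarrow> continuous_on C (F k bs)) \<and>
      (\<forall>bs. \<forall>b\<in>Basis. \<forall>x\<in>S. set bs \<subseteq> Basis \<longrightarrow>
         ((\<lambda>h. F k bs (x + h *\<^sub>R b)) has_real_derivative F k (b # bs) x) (at 0))"
    using choice[of "\<lambda>k D. D [] = f k \<and>
      (\<forall>bs. set bs \<subseteq> Basis \<longrightarrow> continuous_on C (D bs)) \<and>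
      (\<forall>bs. \<forall>b\<in>Basis. \<forall>x\<in>S. set bs \<subseteq> Basis \<longrightarrow>
         ((\<lambda>h. D bs (x + h *\<^sub>R b)) has_real_derivative D (b # bs) x) (at 0))"] by blast
  show thesis by (rule that[of F]) (use F in auto)
qed

lemma C_time_space_space_family:
  assumes "C_time_space j k T \<Omega> \<eta>"
  obtains D :: "'a::euclidean_space list \<Rightarrow> real \<Rightarrow> 'a \<Rightarrow> real" where "D [] = \<eta>"
      "\<And>bs. set bs \<subseteq> Basis \<Longrightarrow> length bs \<le> k \<Longrightarrow> continuous_on ({0..T} \<times> closure \<Omega>) (\<lambda>(t, x). D bs t x)"
      "\<And>bs b t x. set bs \<subseteq> Basis \<Longrightarrow> length bs < k \<Longrightarrow> b\<in>Basis \<Longrightarrow> t\<in>{0..T} \<Longrightarrow> x\<in>\<Omega> \<Longrightarrow>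
         ((\<lambda>h. D bs t (x + h *\<^sub>R b)) has_real_derivative D (b # bs) t x) (at 0)"
proof -
  from assms[unfolded C_time_space_def, THEN conjunct2] obtain D :: "'a list \<Rightarrow> real \<Rightarrow> 'a \<Rightarrow> real"
    where D: "D [] = \<eta> \<and>
      (\<forall>bs. set bs \<subseteq> Basis \<and> length bs \<le> k \<longrightarrow>
         continuous_on ({0..T} \<times> closure \<Omega>) (\<lambda>(t, x). D bs t x)) \<and>
      (\<forall>bs. \<forall>b\<in>Basis. \<forall>t\<in>{0..T}. \<forall>x\<in>\<Omega>. set bs \<subseteq> Basis \<and> length bs < k \<longrightarrow>
         ((\<lambda>h. D bs t (x + h *\<^sub>R b)) has_real_derivative D (b # bs) t x) (at 0))" ..
  show thesis by (rule that[of D]; use D in blast)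
qed

lemma C_time_space_time_family:
  assumes "C_time_space j k T \<Omega> \<eta>"
  obtains E :: "nat \<Rightarrow> real \<Rightarrow> 'a::euclidean_space \<Rightarrow> real" where "E 0 = \<eta>"
      "\<And>i. i \<le> j \<Longrightarrow> continuous_on ({0..T} \<times> closure \<Omega>) (\<lambda>(t, x). E i t x)"
      "\<And>i t x. i < j \<Longrightarrow> t\<in>{0..T} \<Longrightarrow> x\<in>closure \<Omega> \<Longrightarrow>
         ((\<lambda>s. E i s x) has_real_derivative E (Suc i) t x) (at t within {0..T})"
proof -
  from assms[unfolded C_time_space_def, THEN conjunct1] obtain E :: "nat \<Rightarrow> real \<Rightarrow> 'a \<Rightarrow> real"
    where E: "E 0 = \<eta> \<and>
      (\<forall>i\<le>j. continuous_on ({0..T} \<times> closure \<Omega>) (\<lambda>(t, x). E i t x)) \<and>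
      (\<forall>i<j. \<forall>t\<in>{0..T}. \<forall>x\<in>closure \<Omega>.
         ((\<lambda>s. E i s x) has_real_derivative E (Suc i) t x) (at t within {0..T}))" ..
  show thesis by (rule that[of E]; use E in blast)
qed

lemma continuous_on_linear_exponent:
  assumes "\<And>k. continuous_on C (F k bs)"
  shows "continuous_on ((A \<times> C) \<times> UNIV) (\<lambda>(p, w). linear_exponent F bs (snd p) w)"
  unfolding linear_exponent_def case_prod_unfold
  by (intro continuous_intros continuous_on_compose2[OF assms]) auto

lemma continuous_on_twisted:
  fixes F :: "'n::finite \<Rightarrow> 'a::euclidean_space list \<Rightarrow> 'a \<Rightarrow> real"
  assumes F: "\<And>k bs. set bs \<subseteq> Basis \<Longrightarrow> continuous_on C (F k bs)"
    and D: "\<And>bs. set bs \<subseteq> Basis \<Longrightarrow> length bs \<le> 2 \<Longrightarrow> continuous_on (A \<times> C) (\<lambda>(t, x). D bs t x)"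
    and bs: "set bs \<subseteq> Basis" "length bs \<le> 2"
  shows "continuous_on ((A \<times> C) \<times> UNIV) (\<lambda>(p, w). twisted F D bs p w)"
proof -
  have L: "continuous_on ((A \<times> C) \<times> UNIV) (\<lambda>q. linear_exponent F cs (snd (fst q)) (snd q))" if "set cs \<subseteq> Basis" for cs
    using continuous_on_linear_exponent[where F = F and bs = cs, OF F[OF that]] by (simp add: case_prod_unfold)
  have E: "continuous_on ((A \<times> C) \<times> (UNIV :: (real ^ 'n) set)) (\<lambda>q. D cs (fst (fst q)) (snd (fst q)))" if "set cs \<subseteq> Basis" "length cs \<le> 2" for cs
  proof -
    have "continuous_on ((A \<times> C) \<times> (UNIV :: (real ^ 'n) set)) (\<lambda>q. (\<lambda>(t, x). D cs t x) (fst q))"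
      by (rule continuous_on_compose2[OF D[OF that]]) (auto intro!: continuous_intros)
    then show ?thesis by (simp add: case_prod_unfold)
  qed
  have S: "(\<lambda>(p, w). twisted F D bs p w) = (\<lambda>q. twisted F D bs (fst (fst q), snd (fst q)) (snd q))"
    by (simp add: case_prod_unfold)
  consider "bs = []" | b where "bs = [b]" | c b where "bs = [c, b]"
    using bs(2) by (cases bs; cases "tl bs"; cases "tl (tl bs)") auto
  then show ?thesis
  proof cases
    case 1
    show ?thesis unfolding S unfolding 1 twisted.simps by (intro continuous_intros L E) auto
  next
    case (2 b)
    then show ?thesis using bs unfolding S unfolding 2 twisted.simps by (intro continuous_intros L E) auto
  next
    case (3 c b)
    then show ?thesis using bs unfolding S unfolding 3 twisted.simps by (intro continuous_intros L E) auto
  qed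
qed

lemma twisted_has_derivative:
  assumes F: "\<And>k bs b. set bs \<subseteq> Basis \<Longrightarrow> b \<in> Basis \<Longrightarrow>
       ((\<lambda>h. F k bs (x + h *\<^sub>R b)) has_real_derivative F k (b # bs) x) (at 0)"
    and D: "\<And>bs b. set bs \<subseteq> Basis \<Longrightarrow> length bs < 2 \<Longrightarrow> b \<in> Basis \<Longrightarrow>
       ((\<lambda>h. D bs t (x + h *\<^sub>R b)) has_real_derivative D (b # bs) t x) (at 0)"
    and bs: "set bs \<subseteq> Basis" "length bs < 2" and b: "b \<in> (Basis :: 'a::euclidean_space set)"
  shows "((\<lambda>h. twisted F D bs (t, x + h *\<^sub>R b) w) has_real_derivative twisted F D (b # bs) (t, x) w) (at 0)"
proof -
  have L: "((\<lambda>h. linear_exponent F cs (x + h *\<^sub>R b) w) has_real_derivative linear_exponent F (b # cs) x w) (at 0)"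
    if "set cs \<subseteq> Basis" for cs
    unfolding linear_exponent_def by (auto intro!: derivative_eq_intros F that b)
  have E: "((\<lambda>h. exp (linear_exponent F [] (x + h *\<^sub>R b) w)) has_real_derivative
      exp (linear_exponent F [] x w) * linear_exponent F [b] x w) (at 0)"
    using DERIV_fun_exp[OF L[of "[]"]] by simp
  consider "bs = []" | c where "bs = [c]"
    using bs(2) by (cases bs; cases "tl bs") auto
  then show ?thesis
  proof cases
    case 1
    then show ?thesis
      using DERIV_mult[OF E D[of "[]", OF _ _ b]] by (simp add: algebra_simps)
  next
    case 2
    then have c: "set [c] \<subseteq> Basis" using bs by simp
    show ?thesis unfolding 2
      using DERIV_mult[OF E DERIV_add[OF D[OF c _ b] DERIV_mult[OF L[OF c] D[of "[]", OF _ _ b]]]]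
      by (simp add: algebra_simps)
  qed
qed

text \<open>
  The classes of test functions postulate a derivative family in the open set only, whereas the
  Laplacian is an iterated \<^const>\<open>deriv\<close> along lines; both agree because a line through
  \<open>x\<close> stays in the open set for a short while.
\<close>
lemma laplacian_eq_sum:
  assumes \<Omega>: "open \<Omega>" and x: "x \<in> \<Omega>"
    and D0: "\<And>y. y \<in> \<Omega> \<Longrightarrow> u y = D [] y"
    and D: "\<And>bs b y. y \<in> \<Omega> \<Longrightarrow> set bs \<subseteq> Basis \<Longrightarrow> length bs < 2 \<Longrightarrow> b \<in> Basis \<Longrightarrow>
       ((\<lambda>h. D bs (y + h *\<^sub>R b)) has_real_derivative D (b # bs) y) (at 0)"
  shows "laplacian u x = (\<Sum>b\<in>Basis. D [b, b] x)"
  unfolding laplacian_def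
proof (rule sum.cong[OF refl])
  fix b :: 'a assume b: "b \<in> Basis"
  have "((\<lambda>h. x + h *\<^sub>R b) \<longlongrightarrow> x + 0 *\<^sub>R b) (nhds (0::real))"
    by (intro tendsto_intros filterlim_ident)
  then have ev: "\<forall>\<^sub>F h in nhds (0::real). x + h *\<^sub>R b \<in> \<Omega>"
    using \<Omega> x by (simp add: tendsto_def)
  then have ev': "\<forall>\<^sub>F h in nhds (0::real). \<forall>\<^sub>F k in nhds h. x + k *\<^sub>R b \<in> \<Omega>"
    by (simp add: eventually_eventually)
  have first: "deriv (\<lambda>h. u (x + h *\<^sub>R b)) h = D [b] (x + h *\<^sub>R b)" if h: "\<forall>\<^sub>F k in nhds h. x + k *\<^sub>R b \<in> \<Omega>" for h
  proof -
    have "deriv (\<lambda>h. u (x + h *\<^sub>R b)) h = deriv (\<lambda>h. D [] (x + h *\<^sub>R b)) h"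
      by (rule deriv_cong_ev[OF _ refl]) (use h D0 in \<open>auto elim: eventually_mono\<close>)
    also have "\<dots> = D [b] (x + h *\<^sub>R b)"
    proof (rule DERIV_imp_deriv)
      have "x + h *\<^sub>R b \<in> \<Omega>" using h by (rule eventually_nhds_x_imp_x)
      from D[OF this, of "[]" b] b
      have "((\<lambda>k. D [] (x + (h + k) *\<^sub>R b)) has_real_derivative D [b] (x + h *\<^sub>R b)) (at 0)"
        by (simp add: scaleR_left_distrib add.assoc)
      then show "((\<lambda>h. D [] (x + h *\<^sub>R b)) has_real_derivative D [b] (x + h *\<^sub>R b)) (at h)"
        using DERIV_shift[of "\<lambda>h. D [] (x + h *\<^sub>R b)" _ 0 h] by (simp add: add.commute)
    qed
    finally show ?thesis .
  qed
  have "(deriv ^^ 2) (\<lambda>h. u (x + h *\<^sub>R b)) 0 = deriv (deriv (\<lambda>h. u (x + h *\<^sub>R b))) 0"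
    by (simp add: numeral_2_eq_2)
  also have "\<dots> = deriv (\<lambda>h. D [b] (x + h *\<^sub>R b)) 0"
    by (rule deriv_cong_ev[OF _ refl]) (use ev' first in \<open>auto elim: eventually_mono\<close>)
  also have "\<dots> = D [b, b] x"
    using D[OF x, of "[b]" b] b by (intro DERIV_imp_deriv) auto
  finally show "(deriv ^^ 2) (\<lambda>h. u (x + h *\<^sub>R b)) 0 = D [b, b] x" .
qed

lemma mu_eq_linear_exponent: "(\<And>k. F k [] = f k) \<Longrightarrow> \<mu> f v t x = linear_exponent F [] x (v t)"
  by (simp add: \<mu>_def linear_exponent_def)

lemma exp_mu_space_family:
  fixes f :: "'n::finite \<Rightarrow> 'a::euclidean_space \<Rightarrow> real"
  assumes f: "\<And>k. smooth_upto \<Omega> (closure \<Omega>) (f k)" and \<eta>: "C_time_space j 2 T \<Omega> \<eta>"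
  obtains P :: "'a list \<Rightarrow> real \<times> 'a \<Rightarrow> real ^ 'n \<Rightarrow> real" where
    "\<And>w t x. P [] (t, x) w = exp (\<mu> f (\<lambda>t. w) t x) * \<eta> t x"
    "\<And>bs. set bs \<subseteq> Basis \<Longrightarrow> length bs \<le> 2 \<Longrightarrow>
       continuous_on (({0..T} \<times> closure \<Omega>) \<times> UNIV) (\<lambda>(p, w). P bs p w)"
    "\<And>bs b t x w. set bs \<subseteq> Basis \<Longrightarrow> length bs < 2 \<Longrightarrow> b \<in> Basis \<Longrightarrow> t \<in> {0..T} \<Longrightarrow> x \<in> \<Omega> \<Longrightarrow>
       ((\<lambda>h. P bs (t, x + h *\<^sub>R b) w) has_real_derivative P (b # bs) (t, x) w) (at 0)"
proof -
  obtain F where F: "\<And>k. F k [] = f k"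
    "\<And>k bs. set bs \<subseteq> Basis \<Longrightarrow> continuous_on (closure \<Omega>) (F k bs)"
    "\<And>k bs b x. set bs \<subseteq> Basis \<Longrightarrow> b \<in> Basis \<Longrightarrow> x \<in> \<Omega> \<Longrightarrow>
       ((\<lambda>h. F k bs (x + h *\<^sub>R b)) has_real_derivative F k (b # bs) x) (at 0)"
    by (rule smooth_upto_family[where f = f, OF f]) (rule that)
  obtain D where D: "D [] = \<eta>"
      "\<And>bs. set bs \<subseteq> Basis \<Longrightarrow> length bs \<le> 2 \<Longrightarrow> continuous_on ({0..T} \<times> closure \<Omega>) (\<lambda>(t, x). D bs t x)"
      "\<And>bs b t x. set bs \<subseteq> Basis \<Longrightarrow> length bs < 2 \<Longrightarrow> b\<in>Basis \<Longrightarrow> t\<in>{0..T} \<Longrightarrow> x\<in>\<Omega> \<Longrightarrow>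
         ((\<lambda>h. D bs t (x + h *\<^sub>R b)) has_real_derivative D (b # bs) t x) (at 0)"
    by (rule C_time_space_space_family[OF \<eta>]) (rule that)
  show thesis
  proof (rule that[of "twisted F D"])
    show "twisted F D [] (t, x) w = exp (\<mu> f (\<lambda>t. w) t x) * \<eta> t x" for w t x
      by (simp add: D(1) mu_eq_linear_exponent[where F = F and f = f, OF F(1)])
  qed (use F(2,3) D(2,3) in \<open>auto intro!: continuous_on_twisted twisted_has_derivative\<close>)
qed

lemma continuous_along_path:
  assumes P: "continuous_on ((A \<times> C) \<times> UNIV) (\<lambda>(p, w). P p w)" and v: "continuous_on A v"
  shows "continuous_on (A \<times> C) (\<lambda>(t, x). P (t, x) (v t))"
proof -
  have "continuous_on (A \<times> C) (\<lambda>p. (\<lambda>(p, w). P p w) (p, v (fst p)))"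
    by (rule continuous_on_compose2[OF P]) (auto intro!: continuous_intros continuous_on_compose2[OF v])
  then show ?thesis by (simp add: case_prod_unfold)
qed

lemma mu_const: "\<mu> f (\<lambda>s. v t) t x = \<mu> f v t x"
  by (simp add: \<mu>_def)

lemma exp_mu_space_regular:
  fixes f :: "'n::finite \<Rightarrow> 'a::euclidean_space \<Rightarrow> real"
  assumes f: "\<And>k. smooth_upto \<Omega> (closure \<Omega>) (f k)" and \<eta>: "C_time_space j 2 T \<Omega> \<eta>"
    and v: "continuous_on {0..T} v"
  shows "\<exists>D :: 'a list \<Rightarrow> real \<Rightarrow> 'a \<Rightarrow> real. D [] = (\<lambda>t x. exp (\<mu> f v t x) * \<eta> t x) \<and>
      (\<forall>bs. set bs \<subseteq> Basis \<and> length bs \<le> 2 \<longrightarrow>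
         continuous_on ({0..T} \<times> closure \<Omega>) (\<lambda>(t, x). D bs t x)) \<and>
      (\<forall>bs. \<forall>b\<in>Basis. \<forall>t\<in>{0..T}. \<forall>x\<in>\<Omega>. set bs \<subseteq> Basis \<and> length bs < 2 \<longrightarrow>
         ((\<lambda>h. D bs t (x + h *\<^sub>R b)) has_real_derivative D (b # bs) t x) (at 0))"
proof -
  obtain P where P: "\<And>w t x. P [] (t, x) w = exp (\<mu> f (\<lambda>t. w) t x) * \<eta> t x"
    "\<And>bs. set bs \<subseteq> Basis \<Longrightarrow> length bs \<le> 2 \<Longrightarrow>
       continuous_on (({0..T} \<times> closure \<Omega>) \<times> UNIV) (\<lambda>(p, w). P bs p w)"
    "\<And>bs b t x w. set bs \<subseteq> Basis \<Longrightarrow> length bs < 2 \<Longrightarrow> b \<in> Basis \<Longrightarrow> t \<in> {0..T} \<Longrightarrow> x \<in> \<Omega> \<Longrightarrow>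
       ((\<lambda>h. P bs (t, x + h *\<^sub>R b) w) has_real_derivative P (b # bs) (t, x) w) (at 0)"
    by (rule exp_mu_space_family[where f = f, OF f \<eta>]) (rule that)
  show ?thesis
    by (intro exI[of _ "\<lambda>bs t x. P bs (t, x) (v t)"] conjI allI impI ballI)
      (auto simp: P(1) mu_const intro!: continuous_along_path[OF P(2) v] P(3))
qed

lemma test_function_exp_mu_continuous:
  fixes f :: "'n::finite \<Rightarrow> 'a::euclidean_space \<Rightarrow> real"
  assumes f: "\<And>k. smooth_upto \<Omega> (closure \<Omega>) (f k)" and \<eta>: "test_function j T \<Omega> \<eta>"
    and v: "continuous_on {0..T} v"
  shows "test_function 0 T \<Omega> (\<lambda>t x. exp (\<mu> f v t x) * \<eta> t x)"
proof -
  have sp: "C_time_space j 2 T \<Omega> \<eta>" using \<eta> by (simp add: test_function_def)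
  note reg = exp_mu_space_regular[where f = f, OF f sp v]
  then have "continuous_on ({0..T} \<times> closure \<Omega>) (\<lambda>(t, x). exp (\<mu> f v t x) * \<eta> t x)"
    by (elim exE conjE) (metis (mono_tags, lifting) empty_subsetI list.set(1) list.size(3) zero_le)
  then have "C_time_space 0 2 T \<Omega> (\<lambda>t x. exp (\<mu> f v t x) * \<eta> t x)"
    unfolding C_time_space_def
    by (intro conjI reg exI[of _ "\<lambda>i. (\<lambda>t x. exp (\<mu> f v t x) * \<eta> t x)"]) auto
  then show ?thesis using \<eta> by (auto simp: test_function_def)
qed

lemma mu_has_derivative:
  assumes "(v has_vector_derivative v') (at t within S)"
  shows "((\<lambda>s. \<mu> f v s x) has_real_derivative \<mu> f (\<lambda>s. v') t x) (at t within S)"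
proof -
  have "((\<lambda>s. v s $ k) has_real_derivative v' $ k) (at t within S)" for k
    using bounded_linear.has_vector_derivative[OF bounded_linear_vec_nth assms, of k]
    by (simp add: has_real_derivative_iff_has_vector_derivative)
  then show ?thesis unfolding \<mu>_def by (auto intro!: derivative_eq_intros sum.cong simp: mult.commute)
qed

lemma continuous_on_mu:
  fixes f :: "'n::finite \<Rightarrow> 'a::euclidean_space \<Rightarrow> real"
  assumes f: "\<And>k. continuous_on C (f k)" and v: "continuous_on A v"
  shows "continuous_on (A \<times> C) (\<lambda>(t, x). \<mu> f v t x)"
  unfolding \<mu>_def case_prod_unfold
  by (intro continuous_intros continuous_on_compose2[OF f] continuous_on_compose2[OF v]) auto

lemma smooth_upto_continuous: "smooth_upto S C u \<Longrightarrow> continuous_on C u"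
  unfolding smooth_upto_def by (metis empty_subsetI list.set(1))

text \<open>
  A signal that is merely continuous would destroy the time derivative of the product, which is the
  reason for approximating the signal. The derivative of \<open>\<mu>\<close> is \<open>\<mu>\<close> of the derivative, by linearity in the
  signal.
\<close>
lemma test_function_exp_mu_C1:
  fixes f :: "'n::finite \<Rightarrow> 'a::euclidean_space \<Rightarrow> real"
  assumes f: "\<And>k. smooth_upto \<Omega> (closure \<Omega>) (f k)" and \<eta>: "test_function 1 T \<Omega> \<eta>" and T: "T > 0"
    and v: "\<And>t. t \<in> {0..T} \<Longrightarrow> (v has_vector_derivative v' t) (at t within {0..T})"
    and v'c: "continuous_on {0..T} v'"
  shows "test_function 1 T \<Omega> (\<lambda>t x. exp (\<mu> f v t x) * \<eta> t x)"
    and "t \<in> {0..T} \<Longrightarrow> x \<in> closure \<Omega> \<Longrightarrow> time_derivative T (\<lambda>t x. exp (\<mu> f v t x) * \<eta> t x) t x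
      = exp (\<mu> f v t x) * (time_derivative T \<eta> t x + \<mu> f v' t x * \<eta> t x)"
proof -
  have sp: "C_time_space 1 2 T \<Omega> \<eta>" using \<eta> by (simp add: test_function_def)
  obtain E where E: "E 0 = \<eta>" "\<And>i. i \<le> 1 \<Longrightarrow> continuous_on ({0..T} \<times> closure \<Omega>) (\<lambda>(t, x). E i t x)"
    and E0': "\<And>i t x. i < 1 \<Longrightarrow> t\<in>{0..T} \<Longrightarrow> x\<in>closure \<Omega> \<Longrightarrow>
         ((\<lambda>s. E i s x) has_real_derivative E (Suc i) t x) (at t within {0..T})"
    by (rule C_time_space_time_family[OF sp]) (rule that)
  have E': "((\<lambda>s. \<eta> s x) has_real_derivative E 1 t x) (at t within {0..T})" if "t \<in> {0..T}" "x \<in> closure \<Omega>" for t x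
    using E0'[of 0 t x] that E(1) by simp
  have vc: "continuous_on {0..T} v"
    using v has_vector_derivative_continuous continuous_on_eq_continuous_within by blast
  note reg = exp_mu_space_regular[where f = f, OF f sp vc]
  define E1 where "E1 t x = exp (\<mu> f v t x) * (E 1 t x + \<mu> f v' t x * \<eta> t x)" for t x
  have der: "((\<lambda>s. exp (\<mu> f v s x) * \<eta> s x) has_real_derivative E1 t x) (at t within {0..T})"
    if "t \<in> {0..T}" "x \<in> closure \<Omega>" for t x
    unfolding E1_def using mu_has_derivative[OF v[OF that(1)], of f x] E'[OF that]
    by (auto intro!: derivative_eq_intros simp: mu_const algebra_simps)
  have fc: "continuous_on (closure \<Omega>) (f k)" for k using f by (rule smooth_upto_continuous)
  have c0: "continuous_on ({0..T} \<times> closure \<Omega>) (\<lambda>(t, x). exp (\<mu> f v t x) * \<eta> t x)"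
    using E(2)[of 0] continuous_on_mu[OF fc vc] unfolding E(1) case_prod_unfold
    by (intro continuous_intros) auto
  have c1: "continuous_on ({0..T} \<times> closure \<Omega>) (\<lambda>(t, x). E1 t x)"
    using E(2)[of 0] E(2)[of 1] continuous_on_mu[OF fc vc] continuous_on_mu[OF fc v'c]
    unfolding E(1) E1_def case_prod_unfold by (intro continuous_intros) auto
  have "C_time_space 1 2 T \<Omega> (\<lambda>t x. exp (\<mu> f v t x) * \<eta> t x)"
    unfolding C_time_space_def
    by (intro conjI reg exI[of _ "\<lambda>i. if i = 0 then (\<lambda>t x. exp (\<mu> f v t x) * \<eta> t x) else E1"])
      (auto simp: c0 c1 der le_Suc_eq)
  then show "test_function 1 T \<Omega> (\<lambda>t x. exp (\<mu> f v t x) * \<eta> t x)" using \<eta> by (auto simp: test_function_def)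
  show "time_derivative T (\<lambda>t x. exp (\<mu> f v t x) * \<eta> t x) t x
      = exp (\<mu> f v t x) * (time_derivative T \<eta> t x + \<mu> f v' t x * \<eta> t x)"
    if "t \<in> {0..T}" "x \<in> closure \<Omega>"
  proof -
    have "time_derivative T g t x = d" if "((\<lambda>s. g s x) has_real_derivative d) (at t within {0..T})" for g d
      unfolding time_derivative_def
      using that T \<open>t \<in> {0..T}\<close> vector_derivative_within_cbox[of 0 T t "\<lambda>s. g s x" d]
      by (simp add: has_real_derivative_iff_has_vector_derivative)
    from this[of "\<lambda>t x. exp (\<mu> f v t x) * \<eta> t x", OF der[OF that]] this[of \<eta>, OF E'[OF that]] show ?thesis by (simp add: E1_def)
  qed
qed

lemma time_derivative_continuous:
  assumes \<eta>: "test_function 1 T \<Omega> \<eta>" and T: "T > 0"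
  shows "continuous_on ({0..T} \<times> closure \<Omega>) (\<lambda>(t, x). time_derivative T \<eta> t x)"
proof -
  have sp: "C_time_space 1 2 T \<Omega> \<eta>" using \<eta> by (simp add: test_function_def)
  obtain E0 where E0: "E0 0 = \<eta>" "\<And>i. i \<le> 1 \<Longrightarrow> continuous_on ({0..T} \<times> closure \<Omega>) (\<lambda>(t, x). E0 i t x)"
    and E0': "\<And>i t x. i < 1 \<Longrightarrow> t\<in>{0..T} \<Longrightarrow> x\<in>closure \<Omega> \<Longrightarrow>
         ((\<lambda>s. E0 i s x) has_real_derivative E0 (Suc i) t x) (at t within {0..T})"
    by (rule C_time_space_time_family[OF sp]) (rule that)
  define E where "E = E0 1"
  have E: "continuous_on ({0..T} \<times> closure \<Omega>) (\<lambda>(t, x). E t x)" using E0(2)[of 1] by (simp add: E_def)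
  have E': "((\<lambda>s. \<eta> s x) has_real_derivative E t x) (at t within {0..T})" if "t \<in> {0..T}" "x \<in> closure \<Omega>" for t x
    using E0'[of 0 t x] that E0(1) by (simp add: E_def)
  have "time_derivative T \<eta> t x = E t x" if "t \<in> {0..T}" "x \<in> closure \<Omega>" for t x
    unfolding time_derivative_def
    using that T E' vector_derivative_within_cbox[of 0 T t "\<lambda>s. \<eta> s x" "E t x"]
    by (simp add: has_real_derivative_iff_has_vector_derivative)
  then show ?thesis using E by (subst continuous_on_cong[OF refl, where g = "\<lambda>(t, x). E t x"]) auto
qed

text \<open>
  Joint continuity in the point and the signal value lets the Laplacian terms of the weak formulations
  pass to the limit along uniformly convergent signals.
\<close>
lemma laplacian_exp_mu:
  fixes f :: "'n::finite \<Rightarrow> 'a::euclidean_space \<Rightarrow> real"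
  assumes \<Omega>: "open \<Omega>" and f: "\<And>k. smooth_upto \<Omega> (closure \<Omega>) (f k)" and \<eta>: "test_function j T \<Omega> \<eta>"
  obtains Q :: "real \<times> 'a \<Rightarrow> real ^ 'n \<Rightarrow> real" where
    "continuous_on (({0..T} \<times> closure \<Omega>) \<times> UNIV) (\<lambda>(p, w). Q p w)"
    "\<And>v t x. t \<in> {0..T} \<Longrightarrow> x \<in> \<Omega> \<Longrightarrow> laplacian (\<lambda>y. exp (\<mu> f v t y) * \<eta> t y) x = Q (t, x) (v t)"
proof -
  have sp: "C_time_space j 2 T \<Omega> \<eta>" using \<eta> by (simp add: test_function_def)
  obtain P where P: "\<And>w t x. P [] (t, x) w = exp (\<mu> f (\<lambda>t. w) t x) * \<eta> t x"
    "\<And>bs. set bs \<subseteq> Basis \<Longrightarrow> length bs \<le> 2 \<Longrightarrow>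
       continuous_on (({0..T} \<times> closure \<Omega>) \<times> UNIV) (\<lambda>(p, w). P bs p w)"
    "\<And>bs b t x w. set bs \<subseteq> Basis \<Longrightarrow> length bs < 2 \<Longrightarrow> b \<in> Basis \<Longrightarrow> t \<in> {0..T} \<Longrightarrow> x \<in> \<Omega> \<Longrightarrow>
       ((\<lambda>h. P bs (t, x + h *\<^sub>R b) w) has_real_derivative P (b # bs) (t, x) w) (at 0)"
    by (rule exp_mu_space_family[where f = f, OF f sp]) (rule that)
  show thesis
  proof (rule that[of "\<lambda>p w. \<Sum>b\<in>Basis. P [b, b] p w"])
    have "continuous_on (({0..T} \<times> closure \<Omega>) \<times> UNIV) (\<lambda>q. P [b, b] (fst q) (snd q))" if "b \<in> Basis" for b
      using P(2)[of "[b, b]"] that by (simp add: case_prod_unfold)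
    then show "continuous_on (({0..T} \<times> closure \<Omega>) \<times> UNIV) (\<lambda>(p, w). \<Sum>b\<in>Basis. P [b, b] p w)"
      unfolding case_prod_unfold by (intro continuous_intros) auto
    show "laplacian (\<lambda>y. exp (\<mu> f v t y) * \<eta> t y) x = (\<Sum>b\<in>Basis. P [b, b] (t, x) (v t))"
      if "t \<in> {0..T}" "x \<in> \<Omega>" for v t x
      by (rule laplacian_eq_sum[OF \<Omega> that(2), of _ "\<lambda>bs x. P bs (t, x) (v t)"])
        (use that in \<open>auto simp: P(1) mu_const intro!: P(3)\<close>)
  qed
qed

section \<open>Pairings with the solution\<close>

lemma integral_cyl_cong:
  assumes "open \<Omega>" "\<And>t x. t \<in> {0..T} \<Longrightarrow> x \<in> \<Omega> \<Longrightarrow> u t x = v t x"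
  shows "integral_cyl T \<Omega> u = integral_cyl T \<Omega> v"
  unfolding integral_cyl_def set_lebesgue_integral_def
  by (rule Bochner_Integration.integral_cong[OF refl]) (use assms in \<open>auto simp: indicator_def\<close>)

locale noise_setting =
  fixes \<Omega> :: "'a::euclidean_space set" and T :: real
    and f :: "'n::finite \<Rightarrow> 'a \<Rightarrow> real" and X :: "real \<Rightarrow> 'a \<Rightarrow> real"
  assumes open_domain: "open \<Omega>" and bounded_domain: "bounded \<Omega>" and T_pos: "T > 0"
    and smooth: "\<And>k. smooth_upto \<Omega> (closure \<Omega>) (f k)"
    and X_L1: "L1_cyl T \<Omega> X"
    and pairing: "\<And>k \<eta>. test_function 0 T \<Omega> \<eta> \<Longrightarrow> continuous_pairing T \<Omega> (f k) X \<eta>"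
begin

abbreviation cyl :: "(real \<times> 'a) set" where "cyl \<equiv> {0..T} \<times> closure \<Omega>"

text \<open>
  The pairing of \<open>f k * X t\<close> with \<open>exp \<mu> * \<eta> t\<close>, where the signal is frozen at the value \<open>w\<close>. It
  separates the dependence on the signal, which has to be perturbed, from the one on time.
\<close>
definition frozen_pairing :: "'n \<Rightarrow> (real \<Rightarrow> 'a \<Rightarrow> real) \<Rightarrow> real \<Rightarrow> real ^ 'n \<Rightarrow> real" where
  "frozen_pairing k \<eta> t w = space_pairing \<Omega> (f k) X (\<lambda>s x. exp (\<mu> f (\<lambda>_. w) s x) * \<eta> s x) t"

lemma compact_cyl: "compact cyl"
  using bounded_domain by (intro compact_Times) auto

lemma cyl_sub: "{0..T} \<times> \<Omega> \<subseteq> cyl" "{0..T} \<times> \<Omega> \<in> sets borel"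
  using closure_subset open_domain by (auto simp: borel_prod[symmetric])

lemma f_continuous: "continuous_on (closure \<Omega>) (f k)"
  by (rule smooth_upto_continuous[OF smooth])

lemma exp_mu_continuous: "continuous_on (cyl \<times> UNIV) (\<lambda>(p, w). exp (\<mu> f (\<lambda>_. w) (fst p) (snd p)))"
  unfolding \<mu>_def case_prod_unfold
  by (intro continuous_intros continuous_on_compose2[OF f_continuous]) auto

lemma test_function_weaken: "test_function 1 T \<Omega> \<eta> \<Longrightarrow> test_function 0 T \<Omega> \<eta>"
  using test_function_exp_mu_continuous[where f = f and v = "\<lambda>_. 0", OF smooth, of 1 T \<eta>] by (simp add: \<mu>_def)

lemma frozen_pairing_path:
  "frozen_pairing k \<eta> t (v t) = space_pairing \<Omega> (f k) X (\<lambda>s x. exp (\<mu> f v s x) * \<eta> s x) t"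
  by (simp add: frozen_pairing_def space_pairing_def mu_const)

text \<open>
  Along a continuous signal \<open>v\<close> the product \<open>exp \<mu> * \<eta>\<close> is a test function of class
  \<open>C\<^sup>0\<^sup>,\<^sup>2\<close>, so that the continuity of the pairings is the continuity of
  \<open>frozen_pairing\<close> along the path \<open>v\<close>. At a fixed time the integrand is an integrable function times a
  function that depends continuously on \<open>w\<close>, uniformly in space. Hence \<open>frozen_pairing\<close> is jointly
  continuous, although no bound on \<open>X t\<close> that is uniform in \<open>t\<close> is given.
\<close>
lemma frozen_pairing_continuous:
  assumes \<eta>: "test_function 1 T \<Omega> \<eta>"
  shows "continuous_on ({0..T} \<times> UNIV) (\<lambda>(t, w). frozen_pairing k \<eta> t w)"
proof (rule joint_continuity_from_paths)
  fix t assume t: "t \<in> {0..T}"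
  show "continuous_on UNIV (frozen_pairing k \<eta> t)"
    unfolding continuous_on_sequentially
  proof (intro allI ballI impI, elim conjE)
    fix ws :: "nat \<Rightarrow> real ^ 'n" and w assume lim: "ws \<longlonglongrightarrow> w"
    define u where "u x = f k x * X t x * \<eta> t x" for x
    define E where "E x w = exp (\<mu> f (\<lambda>_. w) t x)" for x w
    have Ec: "continuous_on (closure \<Omega> \<times> UNIV) (\<lambda>(x, w). E x w)"
      unfolding E_def \<mu>_def case_prod_unfold
      by (intro continuous_intros continuous_on_compose2[OF f_continuous]) auto
    have Ecw: "continuous_on (closure \<Omega>) (\<lambda>x. E x w)" for w
      unfolding E_def \<mu>_def by (intro continuous_intros f_continuous)
    have ul: "uniform_limit (closure \<Omega>) (\<lambda>n x. E x (ws n)) (\<lambda>x. E x w) sequentially"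
    proof (rule uniform_limit_compose_jointly_continuous[OF _ Ec])
      show "uniform_limit (closure \<Omega>) (\<lambda>n x. ws n) (\<lambda>x. w) sequentially"
        using lim unfolding uniform_limit_iff tendsto_iff by (auto elim: eventually_mono)
    qed (use bounded_domain in auto)
    have u: "set_integrable lebesgue \<Omega> u"
      using pairing[OF test_function_weaken[OF \<eta>]] t by (simp add: continuous_pairing_def L1_def u_def[abs_def])
    have "(\<lambda>n. LINT x:\<Omega>|lebesgue. u x * E x (ws n)) \<longlonglongrightarrow> (LINT x:\<Omega>|lebesgue. u x * E x w)"
      by (rule set_integral_mult_tendsto[OF u _ closure_subset _ Ecw ul]) (use open_domain bounded_domain in auto)
    moreover have "frozen_pairing k \<eta> t w = (LINT x:\<Omega>|lebesgue. u x * E x w)" for w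
      by (simp add: frozen_pairing_def space_pairing_def u_def E_def mult_ac)
    ultimately show "(frozen_pairing k \<eta> t \<circ> ws) \<longlonglongrightarrow> frozen_pairing k \<eta> t w" by (simp add: o_def)
  qed
next
  fix v :: "real \<Rightarrow> real ^ 'n" assume v: "continuous_on {0..T} v"
  show "continuous_on {0..T} (\<lambda>t. frozen_pairing k \<eta> t (v t))"
    using pairing[OF test_function_exp_mu_continuous[where f = f, OF smooth \<eta> v]]
    by (simp add: continuous_pairing_def frozen_pairing_path[abs_def])
qed

lemma integral_cyl_tendsto_along_paths:
  assumes u: "L1_cyl T \<Omega> u" and Q: "continuous_on (cyl \<times> UNIV) (\<lambda>(p, w). Q p w)"
    and vn: "\<And>n. continuous_on {0..T} (vn n)" and lim: "uniform_limit {0..T} vn v sequentially"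
  shows "(\<lambda>n. integral_cyl T \<Omega> (\<lambda>t x. u t x * Q (t, x) (vn n t :: real ^ 'n)))
    \<longlonglongrightarrow> integral_cyl T \<Omega> (\<lambda>t x. u t x * Q (t, x) (v t))"
proof -
  have v: "continuous_on {0..T} v" using vn by (intro uniform_limit_theorem[OF _ lim]) auto
  have "uniform_limit cyl (\<lambda>n p. Q p (vn n (fst p))) (\<lambda>p. Q p (v (fst p))) sequentially"
  proof (rule uniform_limit_compose_jointly_continuous[OF compact_cyl Q])
    show "uniform_limit cyl (\<lambda>n p. vn n (fst p)) (\<lambda>p. v (fst p)) sequentially"
      using lim unfolding uniform_limit_iff by (auto elim: eventually_mono)
    show "continuous_on cyl (\<lambda>p. v (fst p))"
      by (rule continuous_on_compose2[OF v]) (auto intro!: continuous_intros)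
  qed
  moreover have "continuous_on cyl (\<lambda>p. Q p (vn n (fst p)))" for n
    using continuous_along_path[OF Q vn] by (simp add: case_prod_unfold)
  ultimately have "(\<lambda>n. LINT p:{0..T} \<times> \<Omega>|lebesgue. (\<lambda>(t, x). u t x) p * Q p (vn n (fst p)))
    \<longlonglongrightarrow> (LINT p:{0..T} \<times> \<Omega>|lebesgue. (\<lambda>(t, x). u t x) p * Q p (v (fst p)))"
    using u unfolding L1_cyl_def by (intro set_integral_mult_tendsto[OF _ cyl_sub(2,1) compact_cyl])
  then show ?thesis by (simp add: integral_cyl_def case_prod_unfold)
qed

lemma L1_cyl_mult_continuous:
  assumes u: "L1_cyl T \<Omega> u" and g: "continuous_on cyl (\<lambda>(t, x). g t x)"
  shows "L1_cyl T \<Omega> (\<lambda>t x. u t x * g t x)"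
  using set_integrable_mult_continuous[OF u[unfolded L1_cyl_def] cyl_sub(2,1) compact_cyl g]
  by (simp add: L1_cyl_def case_prod_unfold)

lemma integral_cyl_add:
  assumes "L1_cyl T \<Omega> u" "L1_cyl T \<Omega> v"
  shows "integral_cyl T \<Omega> (\<lambda>t x. u t x + v t x) = integral_cyl T \<Omega> u + integral_cyl T \<Omega> v"
  using set_integral_add(2)[OF assms[unfolded L1_cyl_def]] by (simp add: integral_cyl_def case_prod_unfold)

lemma integral_cyl_sum:
  assumes "finite I" "\<And>i. i \<in> I \<Longrightarrow> L1_cyl T \<Omega> (u i)"
  shows "integral_cyl T \<Omega> (\<lambda>t x. \<Sum>i\<in>I. u i t x) = (\<Sum>i\<in>I. integral_cyl T \<Omega> (u i))"
  using assms unfolding integral_cyl_def L1_cyl_def case_prod_unfold set_lebesgue_integral_def set_integrable_def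
    scaleR_sum_right
  by (intro Bochner_Integration.integral_sum)

lemma test_function_continuous:
  assumes "test_function j T \<Omega> \<eta>" shows "continuous_on cyl (\<lambda>(t, x). \<eta> t x)"
proof -
  have "C_time_space j 2 T \<Omega> \<eta>" using assms by (simp add: test_function_def)
  then obtain E where "E 0 = \<eta>" "\<And>i. i \<le> j \<Longrightarrow> continuous_on ({0..T} \<times> closure \<Omega>) (\<lambda>(t, x). E i t x)"
    by (rule C_time_space_time_family) (rule that)
  then show ?thesis by (metis zero_le)
qed

text \<open>
  In the product rule for \<open>exp \<mu> * \<eta>\<close> the derivative of \<open>\<mu>\<close> contributes
  \<open>- (\<Sum>k. f k x * q t $ k)\<close>. Integrating in space first turns this term into one-dimensional
  integrals of the pairings against \<open>q\<close>, the form in which a Riemann-Stieltjes integral appears in the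
  limit.
\<close>
lemma integral_cyl_time_derivative_split:
  assumes \<eta>: "test_function 1 T \<Omega> \<eta>" and v: "continuous_on {0..T} v" and q: "continuous_on {0..T} q"
  shows "integral_cyl T \<Omega> (\<lambda>t x. X t x * (exp (\<mu> f v t x) * (time_derivative T \<eta> t x + \<mu> f q t x * \<eta> t x)))
    = integral_cyl T \<Omega> (\<lambda>t x. X t x * (exp (\<mu> f v t x) * time_derivative T \<eta> t x))
      - (\<Sum>k\<in>UNIV. integral {0..T} (\<lambda>t. frozen_pairing k \<eta> t (v t) * q t $ k))"
proof -
  have \<eta>c: "continuous_on cyl (\<lambda>p. \<eta> (fst p) (snd p))" using test_function_continuous[OF \<eta>] by (simp add: case_prod_unfold)
  have dc: "continuous_on cyl (\<lambda>p. time_derivative T \<eta> (fst p) (snd p))"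
    using time_derivative_continuous[OF \<eta> T_pos] by (simp add: case_prod_unfold)
  have mc: "continuous_on cyl (\<lambda>p. \<mu> f v (fst p) (snd p))"
    using continuous_on_mu[where f = f, OF f_continuous v] by (simp add: case_prod_unfold)
  have fc: "continuous_on cyl (\<lambda>p. f k (snd p))" for k
    by (rule continuous_on_compose2[OF f_continuous]) (auto intro!: continuous_intros)
  have qc: "continuous_on cyl (\<lambda>p. q (fst p))"
    by (rule continuous_on_compose2[OF q]) (auto intro!: continuous_intros)
  define u where "u k t x = X t x * (f k x * exp (\<mu> f v t x) * \<eta> t x * q t $ k)" for k t x
  have uL: "L1_cyl T \<Omega> (u k)" for k
    unfolding u_def case_prod_unfold
    by (intro L1_cyl_mult_continuous X_L1) (auto simp: case_prod_unfold intro!: continuous_intros fc mc \<eta>c qc)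
  have A: "L1_cyl T \<Omega> (\<lambda>t x. X t x * (exp (\<mu> f v t x) * time_derivative T \<eta> t x))"
    by (intro L1_cyl_mult_continuous X_L1) (auto simp: case_prod_unfold intro!: continuous_intros mc dc)
  have N: "L1_cyl T \<Omega> (\<lambda>t x. X t x * (exp (\<mu> f v t x) * \<mu> f q t x * \<eta> t x))"
    using continuous_on_mu[where f = f, OF f_continuous q]
    by (intro L1_cyl_mult_continuous X_L1) (auto simp: case_prod_unfold intro!: continuous_intros mc \<eta>c)
  have tf: "test_function 0 T \<Omega> (\<lambda>t x. exp (\<mu> f v t x) * \<eta> t x)"
    by (rule test_function_exp_mu_continuous[where f = f, OF smooth \<eta> v])
  have pair: "integral_cyl T \<Omega> (u k) = integral {0..T} (\<lambda>t. frozen_pairing k \<eta> t (v t) * q t $ k)" for k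
  proof (rule integral_cyl_eq_iterated[OF open_domain uL])
    note cp = pairing[OF tf, of k, unfolded continuous_pairing_def]
    have ueq: "u k t = (\<lambda>x. f k x * X t x * (exp (\<mu> f v t x) * \<eta> t x) * q t $ k)" for t
      by (simp add: u_def fun_eq_iff mult_ac)
    show "L1 \<Omega> (u k t)" if "t \<in> {0..T}" for t
      using cp that unfolding ueq L1_def by (intro set_integrable_mult_left) auto
    show "continuous_on {0..T} (\<lambda>t. frozen_pairing k \<eta> t (v t) * q t $ k)"
      using cp by (intro continuous_intros q) (simp add: frozen_pairing_path[abs_def])
    show "frozen_pairing k \<eta> t (v t) * q t $ k = (LINT x:\<Omega>|lebesgue. u k t x)" for t
      unfolding ueq frozen_pairing_path space_pairing_def by (rule set_integral_mult_left[symmetric])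
  qed
  have "integral_cyl T \<Omega> (\<lambda>t x. X t x * (exp (\<mu> f v t x) * \<mu> f q t x * \<eta> t x))
      = integral_cyl T \<Omega> (\<lambda>t x. - (\<Sum>k\<in>UNIV. u k t x))"
    by (rule integral_cyl_cong[OF open_domain]) (simp add: u_def \<mu>_def[of f q] sum_distrib_left sum_distrib_right mult_ac)
  also have "\<dots> = - (\<Sum>k\<in>UNIV. integral_cyl T \<Omega> (u k))"
    using integral_cyl_sum[of UNIV u] uL
    by (simp add: integral_cyl_def set_lebesgue_integral_def case_prod_unfold)
  finally have N_eq: "integral_cyl T \<Omega> (\<lambda>t x. X t x * (exp (\<mu> f v t x) * \<mu> f q t x * \<eta> t x))
     = - (\<Sum>k\<in>UNIV. integral {0..T} (\<lambda>t. frozen_pairing k \<eta> t (v t) * q t $ k))" by (simp only: pair)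
  show ?thesis using integral_cyl_add[OF A N] unfolding N_eq by (simp add: algebra_simps)
qed

end

section \<open>Passage to the limit\<close>

text \<open>
  The properties of the continuously differentiable signals \<open>w n\<close>: besides uniform convergence to \<open>z\<close>, a
  common bound on their variations, as the limit theorems for Riemann-Stieltjes integrals demand.
\<close>
locale noise_approximation = noise_setting \<Omega> T f X
  for \<Omega> :: "'a::euclidean_space set" and T :: real
    and f :: "'n::finite \<Rightarrow> 'a \<Rightarrow> real" and X :: "real \<Rightarrow> 'a \<Rightarrow> real" +
  fixes z :: "real \<Rightarrow> real ^ 'n" and w w' :: "nat \<Rightarrow> real \<Rightarrow> real ^ 'n" and V :: real
  assumes w_deriv: "\<And>n t. t \<in> {0..T} \<Longrightarrow> (w n has_vector_derivative w' n t) (at t within {0..T})"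
    and w_cont: "\<And>n. continuous_on {0..T} (w n)"
    and w'_cont: "\<And>n. continuous_on {0..T} (w' n)"
    and w'_bound: "\<And>n. integral {0..T} (\<lambda>t. norm (w' n t)) \<le> V"
    and w_lim: "uniform_limit {0..T} w z sequentially"
begin

lemma z_cont: "continuous_on {0..T} z"
  using w_cont by (intro uniform_limit_theorem[OF _ w_lim]) auto

lemma pairing_integrals_tendsto:
  assumes \<eta>: "test_function 1 T \<Omega> \<eta>"
    and vn: "\<And>n. continuous_on {0..T} (vn n)" and lim: "uniform_limit {0..T} vn v sequentially"
  shows "(\<lambda>n. integral {0..T} (\<lambda>t. frozen_pairing k \<eta> t (vn n t) * w' n t $ k))
      \<longlonglongrightarrow> RS_integral (\<lambda>t. frozen_pairing k \<eta> t (v t)) (\<lambda>t. z t $ k) 0 T"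
    and "(\<lambda>n. RS_integral (\<lambda>t. frozen_pairing k \<eta> t (vn n t)) (\<lambda>t. z t $ k) 0 T)
      \<longlonglongrightarrow> RS_integral (\<lambda>t. frozen_pairing k \<eta> t (v t)) (\<lambda>t. z t $ k) 0 T"
proof -
  have v: "continuous_on {0..T} v" using vn by (intro uniform_limit_theorem[OF _ lim]) auto
  have 1: "0 \<le> T" using T_pos by simp
  have 2: "((\<lambda>t. w n t $ k) has_vector_derivative w' n t $ k) (at t within {0..T})" if "t \<in> {0..T}" for n t
    by (rule bounded_linear.has_vector_derivative[OF bounded_linear_vec_nth w_deriv[OF that]])
  have 3: "continuous_on {0..T} (\<lambda>t. w' n t $ k)" for n by (intro continuous_intros w'_cont)
  have 4: "integral {0..T} (\<lambda>t. \<bar>w' n t $ k\<bar>) \<le> V" for n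
  proof (rule order_trans[OF integral_le w'_bound])
    show "\<bar>w' n t $ k\<bar> \<le> norm (w' n t)" for t by (rule component_le_norm_cart)
  qed (auto intro!: integrable_continuous_real continuous_intros w'_cont)
  have 5: "(\<lambda>n. w n t $ k) \<longlonglongrightarrow> z t $ k" if "t \<in> {0..T}" for t
    using tendsto_uniform_limitI[OF w_lim that] by (rule tendsto_vec_nth)
  have 6: "continuous_on {0..T} (\<lambda>t. frozen_pairing k \<eta> t (vn n t))" for n
  proof -
    have "continuous_on {0..T} (\<lambda>t. (\<lambda>(t, a). frozen_pairing k \<eta> t a) (t, vn n t))"
      by (rule continuous_on_compose2[OF frozen_pairing_continuous[OF \<eta>]]) (auto intro!: continuous_intros vn)
    then show ?thesis by simp
  qed
  have 7: "uniform_limit {0..T} (\<lambda>n t. frozen_pairing k \<eta> t (vn n t)) (\<lambda>t. frozen_pairing k \<eta> t (v t)) sequentially"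
    by (rule uniform_limit_compose_jointly_continuous[OF _ frozen_pairing_continuous[OF \<eta>] lim v]) simp
  show "(\<lambda>n. integral {0..T} (\<lambda>t. frozen_pairing k \<eta> t (vn n t) * w' n t $ k))
      \<longlonglongrightarrow> RS_integral (\<lambda>t. frozen_pairing k \<eta> t (v t)) (\<lambda>t. z t $ k) 0 T"
    by (rule moving_integrands_tendsto_RS_integral(1)[where w = "\<lambda>n t. w n t $ k", OF 1 2 3 4 5 6 7])
  show "(\<lambda>n. RS_integral (\<lambda>t. frozen_pairing k \<eta> t (vn n t)) (\<lambda>t. z t $ k) 0 T)
      \<longlonglongrightarrow> RS_integral (\<lambda>t. frozen_pairing k \<eta> t (v t)) (\<lambda>t. z t $ k) 0 T"
    by (rule moving_integrands_tendsto_RS_integral(2)[where w = "\<lambda>n t. w n t $ k", OF 1 2 3 4 5 6 7])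
qed

lemma initial_integral_tendsto:
  assumes \<eta>: "test_function 1 T \<Omega> \<eta>" and X0: "L1 \<Omega> X0"
    and vn: "\<And>n. continuous_on {0..T} (vn n)" and lim: "uniform_limit {0..T} vn v sequentially"
  shows "(\<lambda>n. LINT x:\<Omega>|lebesgue. X0 x * (exp (\<mu> f (vn n) 0 x) * \<eta> 0 x))
    \<longlonglongrightarrow> (LINT x:\<Omega>|lebesgue. X0 x * (exp (\<mu> f v 0 x) * \<eta> 0 x))"
proof -
  have "continuous_on (closure \<Omega>) (\<lambda>x. (\<lambda>(t, x). \<eta> t x) (0, x))"
    by (rule continuous_on_compose2[OF test_function_continuous[OF \<eta>]]) (use T_pos in \<open>auto intro!: continuous_intros\<close>)
  then have \<eta>c: "continuous_on (closure \<Omega>) (\<eta> 0)" by simp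
  have Qc: "continuous_on (closure \<Omega> \<times> UNIV) (\<lambda>(x, a). exp (\<mu> f (\<lambda>_. a) 0 x) * \<eta> 0 x)"
    unfolding \<mu>_def case_prod_unfold
    by (intro continuous_intros continuous_on_compose2[OF f_continuous] continuous_on_compose2[OF \<eta>c]) auto
  have c: "continuous_on (closure \<Omega>) (\<lambda>x. exp (\<mu> f (\<lambda>_. a) 0 x) * \<eta> 0 x)" for a
    unfolding \<mu>_def by (intro continuous_intros f_continuous \<eta>c)
  have "(\<lambda>n. vn n 0) \<longlonglongrightarrow> v 0" using T_pos by (intro tendsto_uniform_limitI[OF lim]) auto
  then have "uniform_limit (closure \<Omega>) (\<lambda>n x. vn n 0) (\<lambda>x. v 0) sequentially"
    unfolding uniform_limit_iff tendsto_iff by (auto elim: eventually_mono)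
  then have "uniform_limit (closure \<Omega>) (\<lambda>n x. exp (\<mu> f (\<lambda>_. vn n 0) 0 x) * \<eta> 0 x)
     (\<lambda>x. exp (\<mu> f (\<lambda>_. v 0) 0 x) * \<eta> 0 x) sequentially"
    by (intro uniform_limit_compose_jointly_continuous[OF _ Qc]) (use bounded_domain in auto)
  then have "(\<lambda>n. LINT x:\<Omega>|lebesgue. X0 x * (exp (\<mu> f (\<lambda>_. vn n 0) 0 x) * \<eta> 0 x))
    \<longlonglongrightarrow> (LINT x:\<Omega>|lebesgue. X0 x * (exp (\<mu> f (\<lambda>_. v 0) 0 x) * \<eta> 0 x))"
    using X0 open_domain bounded_domain
    by (intro set_integral_mult_tendsto[OF _ _ closure_subset _ c]) (auto simp: L1_def)
  then show ?thesis by (simp add: mu_const)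
qed

lemma time_integral_tendsto:
  assumes \<eta>: "test_function 1 T \<Omega> \<eta>"
    and vn: "\<And>n. continuous_on {0..T} (vn n)" and lim: "uniform_limit {0..T} vn v sequentially"
  shows "(\<lambda>n. integral_cyl T \<Omega> (\<lambda>t x. X t x * (exp (\<mu> f (vn n) t x) * time_derivative T \<eta> t x)))
    \<longlonglongrightarrow> integral_cyl T \<Omega> (\<lambda>t x. X t x * (exp (\<mu> f v t x) * time_derivative T \<eta> t x))"
proof -
  have "continuous_on (cyl \<times> (UNIV :: (real ^ 'n) set)) (\<lambda>q. (\<lambda>(t, x). time_derivative T \<eta> t x) (fst q))"
    by (rule continuous_on_compose2[OF time_derivative_continuous[OF \<eta> T_pos]]) (auto intro!: continuous_intros)
  then have "continuous_on (cyl \<times> UNIV) (\<lambda>(p, a). exp (\<mu> f (\<lambda>_. a) (fst p) (snd p)) * time_derivative T \<eta> (fst p) (snd p))"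
    using exp_mu_continuous unfolding case_prod_unfold by (intro continuous_on_mult)
  from integral_cyl_tendsto_along_paths[OF X_L1 this vn lim] show ?thesis by (simp add: mu_const)
qed

lemma laplacian_integral_tendsto:
  assumes \<eta>: "test_function 1 T \<Omega> \<eta>" and u: "L1_cyl T \<Omega> u"
    and vn: "\<And>n. continuous_on {0..T} (vn n)" and lim: "uniform_limit {0..T} vn v sequentially"
  shows "(\<lambda>n. integral_cyl T \<Omega> (\<lambda>t x. u t x * laplacian (\<lambda>y. exp (\<mu> f (vn n) t y) * \<eta> t y) x))
    \<longlonglongrightarrow> integral_cyl T \<Omega> (\<lambda>t x. u t x * laplacian (\<lambda>y. exp (\<mu> f v t y) * \<eta> t y) x)"
proof -
  obtain Q :: "real \<times> 'a \<Rightarrow> real ^ 'n \<Rightarrow> real" where Q: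
    "continuous_on (cyl \<times> UNIV) (\<lambda>(p, w). Q p w)"
    "\<And>v t x. t \<in> {0..T} \<Longrightarrow> x \<in> \<Omega> \<Longrightarrow> laplacian (\<lambda>y. exp (\<mu> f v t y) * \<eta> t y) x = Q (t, x) (v t)"
    by (rule laplacian_exp_mu[where f = f, OF open_domain smooth \<eta>]) (rule that)
  have "integral_cyl T \<Omega> (\<lambda>t x. u t x * laplacian (\<lambda>y. exp (\<mu> f v t y) * \<eta> t y) x)
      = integral_cyl T \<Omega> (\<lambda>t x. u t x * Q (t, x) (v t))" for v
    by (rule integral_cyl_cong[OF open_domain]) (simp add: Q(2))
  then show ?thesis using integral_cyl_tendsto_along_paths[OF u Q(1) vn lim] by simp
qed

text \<open>
  Test the rough equation with \<open>exp (\<mu> f (w n)) * \<eta>\<close>. The derivative of the exponential produces the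
  integrals \<open>J n k\<close> of the pairings against \<open>w' n\<close>, and the noise term is \<open>R (w n) k\<close>, the integral of
  the same pairings against \<open>z\<close>. Both have the limit \<open>R z k\<close>, and they stand on opposite sides of the
  equation, so the noise cancels. The function \<open>u\<close> stands for \<open>\<Phi> m\<close> applied to \<open>X\<close>.
\<close>
lemma rough_imp_transformed_identity:
  assumes \<eta>: "test_function 1 T \<Omega> \<eta>" and X0: "L1 \<Omega> X0" and u: "L1_cyl T \<Omega> u"
    and rough: "\<And>\<eta>. test_function 1 T \<Omega> \<eta> \<Longrightarrow>
       - integral_cyl T \<Omega> (\<lambda>r x. X r x * time_derivative T \<eta> r x)
         - (LINT x:\<Omega>|lebesgue. X0 x * \<eta> 0 x)
       = integral_cyl T \<Omega> (\<lambda>r x. u r x * laplacian (\<eta> r) x)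
         + (\<Sum>k\<in>UNIV. RS_integral (space_pairing \<Omega> (f k) X \<eta>) (\<lambda>r. z r $ k) 0 T)"
  shows "- integral_cyl T \<Omega> (\<lambda>r x. X r x * (exp (\<mu> f z r x) * time_derivative T \<eta> r x))
         - (LINT x:\<Omega>|lebesgue. X0 x * (exp (\<mu> f z 0 x) * \<eta> 0 x))
       = integral_cyl T \<Omega> (\<lambda>r x. u r x * laplacian (\<lambda>y. exp (\<mu> f z r y) * \<eta> r y) x)"
proof -
  define A where "A v = integral_cyl T \<Omega> (\<lambda>t x. X t x * (exp (\<mu> f v t x) * time_derivative T \<eta> t x))" for v
  define B where "B v = (LINT x:\<Omega>|lebesgue. X0 x * (exp (\<mu> f v 0 x) * \<eta> 0 x))" for v
  define C where "C v = integral_cyl T \<Omega> (\<lambda>t x. u t x * laplacian (\<lambda>y. exp (\<mu> f v t y) * \<eta> t y) x)" for v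
  define J where "J n k = integral {0..T} (\<lambda>t. frozen_pairing k \<eta> t (w n t) * w' n t $ k)" for n k
  define R where "R v k = RS_integral (\<lambda>t. frozen_pairing k \<eta> t (v t)) (\<lambda>t. z t $ k) 0 T" for v k
  have eq: "- (A (w n) - (\<Sum>k\<in>UNIV. J n k)) - B (w n) = C (w n) + (\<Sum>k\<in>UNIV. R (w n) k)" for n
  proof -
    have tf1: "test_function 1 T \<Omega> (\<lambda>t x. exp (\<mu> f (w n) t x) * \<eta> t x)"
      by (rule test_function_exp_mu_C1(1)[where f = f, OF smooth \<eta> T_pos w_deriv w'_cont])
    have tf2: "time_derivative T (\<lambda>t x. exp (\<mu> f (w n) t x) * \<eta> t x) t x
        = exp (\<mu> f (w n) t x) * (time_derivative T \<eta> t x + \<mu> f (w' n) t x * \<eta> t x)"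
      if "t \<in> {0..T}" "x \<in> \<Omega>" for t x
      using that closure_subset[of \<Omega>]
      by (intro test_function_exp_mu_C1(2)[where f = f, OF smooth \<eta> T_pos _ w'_cont] w_deriv) auto
    have "integral_cyl T \<Omega> (\<lambda>r x. X r x * time_derivative T (\<lambda>t x. exp (\<mu> f (w n) t x) * \<eta> t x) r x)
      = integral_cyl T \<Omega> (\<lambda>t x. X t x * (exp (\<mu> f (w n) t x) * (time_derivative T \<eta> t x + \<mu> f (w' n) t x * \<eta> t x)))"
      by (intro integral_cyl_cong[OF open_domain]) (auto simp: tf2)
    also have "\<dots> = A (w n) - (\<Sum>k\<in>UNIV. J n k)"
      unfolding A_def J_def by (rule integral_cyl_time_derivative_split[OF \<eta> w_cont w'_cont])
    finally show ?thesis
      using rough[OF tf1] by (simp add: B_def C_def R_def frozen_pairing_path[abs_def])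
  qed
  have "(\<lambda>n. - (A (w n) - (\<Sum>k\<in>UNIV. J n k)) - B (w n)) \<longlonglongrightarrow> - (A z - (\<Sum>k\<in>UNIV. R z k)) - B z"
    unfolding A_def B_def J_def R_def
    by (intro tendsto_intros time_integral_tendsto[OF \<eta>] initial_integral_tendsto[OF \<eta> X0]
      pairing_integrals_tendsto(1)[OF \<eta>] w_cont w_lim)
  moreover have "(\<lambda>n. C (w n) + (\<Sum>k\<in>UNIV. R (w n) k)) \<longlonglongrightarrow> C z + (\<Sum>k\<in>UNIV. R z k)"
    unfolding C_def R_def
    by (intro tendsto_intros laplacian_integral_tendsto[OF \<eta> u] pairing_integrals_tendsto(2)[OF \<eta>] w_cont w_lim)
  ultimately have "- (A z - (\<Sum>k\<in>UNIV. R z k)) - B z = C z + (\<Sum>k\<in>UNIV. R z k)"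
    unfolding eq by (rule LIMSEQ_unique)
  then show ?thesis by (simp add: A_def B_def C_def)
qed

text \<open>
  Test the transformed equation with \<open>exp (- \<mu> f (w n)) * \<eta>\<close>. The two exponentials combine to
  \<open>exp (\<mu> f (z - w n))\<close>, which tends to \<open>1\<close>, while the derivative of the second one leaves the integrals
  \<open>J n k\<close>, whose limit is the noise term of the rough equation.
\<close>
lemma transformed_imp_rough_identity:
  assumes \<eta>: "test_function 1 T \<Omega> \<eta>" and X0: "L1 \<Omega> X0" and u: "L1_cyl T \<Omega> u"
    and transformed: "\<And>\<eta>. test_function 1 T \<Omega> \<eta> \<Longrightarrow>
       - integral_cyl T \<Omega> (\<lambda>r x. X r x * (exp (\<mu> f z r x) * time_derivative T \<eta> r x))
         - (LINT x:\<Omega>|lebesgue. X0 x * (exp (\<mu> f z 0 x) * \<eta> 0 x))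
       = integral_cyl T \<Omega> (\<lambda>r x. u r x * laplacian (\<lambda>y. exp (\<mu> f z r y) * \<eta> r y) x)"
  shows "- integral_cyl T \<Omega> (\<lambda>r x. X r x * time_derivative T \<eta> r x)
         - (LINT x:\<Omega>|lebesgue. X0 x * \<eta> 0 x)
       = integral_cyl T \<Omega> (\<lambda>r x. u r x * laplacian (\<eta> r) x)
         + (\<Sum>k\<in>UNIV. RS_integral (space_pairing \<Omega> (f k) X \<eta>) (\<lambda>r. z r $ k) 0 T)"
proof -
  define A where "A v = integral_cyl T \<Omega> (\<lambda>t x. X t x * (exp (\<mu> f v t x) * time_derivative T \<eta> t x))" for v
  define B where "B v = (LINT x:\<Omega>|lebesgue. X0 x * (exp (\<mu> f v 0 x) * \<eta> 0 x))" for v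
  define C where "C v = integral_cyl T \<Omega> (\<lambda>t x. u t x * laplacian (\<lambda>y. exp (\<mu> f v t y) * \<eta> t y) x)" for v
  define vn where "vn n t = z t - w n t" for n t
  define J where "J n k = integral {0..T} (\<lambda>t. frozen_pairing k \<eta> t (vn n t) * w' n t $ k)" for n k
  define R where "R k = RS_integral (\<lambda>t. frozen_pairing k \<eta> t 0) (\<lambda>t. z t $ k) 0 T" for k
  have vn: "continuous_on {0..T} (vn n)" for n unfolding vn_def by (intro continuous_intros z_cont w_cont)
  have vlim: "uniform_limit {0..T} vn (\<lambda>_. 0) sequentially"
    using w_lim unfolding vn_def uniform_limit_iff by (simp add: dist_norm norm_minus_commute)
  have exp_vn: "exp (\<mu> f z t x) * (exp (\<mu> f (\<lambda>t. - w n t) t x) * c) = exp (\<mu> f (vn n) t x) * c" for n t x c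
  proof -
    have "\<mu> f z t x + \<mu> f (\<lambda>t. - w n t) t x = \<mu> f (vn n) t x"
      by (simp add: \<mu>_def vn_def sum_subtractf sum_negf algebra_simps)
    then show ?thesis by (metis exp_add mult.assoc)
  qed
  have eq: "- (A (vn n) + (\<Sum>k\<in>UNIV. J n k)) - B (vn n) = C (vn n)" for n
  proof -
    have der: "((\<lambda>t. - w n t) has_vector_derivative - w' n t) (at t within {0..T})" if "t \<in> {0..T}" for t
      by (intro has_vector_derivative_minus w_deriv that)
    have cont: "continuous_on {0..T} (\<lambda>t. - w' n t)" by (intro continuous_intros w'_cont)
    have tf1: "test_function 1 T \<Omega> (\<lambda>t x. exp (\<mu> f (\<lambda>t. - w n t) t x) * \<eta> t x)"
      by (rule test_function_exp_mu_C1(1)[where f = f, OF smooth \<eta> T_pos der cont])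
    have tf2: "time_derivative T (\<lambda>t x. exp (\<mu> f (\<lambda>t. - w n t) t x) * \<eta> t x) t x
        = exp (\<mu> f (\<lambda>t. - w n t) t x) * (time_derivative T \<eta> t x + \<mu> f (\<lambda>t. - w' n t) t x * \<eta> t x)"
      if "t \<in> {0..T}" "x \<in> \<Omega>" for t x
      using that closure_subset[of \<Omega>]
      by (intro test_function_exp_mu_C1(2)[where f = f, OF smooth \<eta> T_pos _ cont] der) auto
    have "integral_cyl T \<Omega> (\<lambda>r x. X r x * (exp (\<mu> f z r x) *
         time_derivative T (\<lambda>t x. exp (\<mu> f (\<lambda>t. - w n t) t x) * \<eta> t x) r x))
      = integral_cyl T \<Omega> (\<lambda>t x. X t x * (exp (\<mu> f (vn n) t x) *
         (time_derivative T \<eta> t x + \<mu> f (\<lambda>t. - w' n t) t x * \<eta> t x)))"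
      by (intro integral_cyl_cong[OF open_domain]) (auto simp: tf2 exp_vn)
    also have "\<dots> = A (vn n) - (\<Sum>k\<in>UNIV. integral {0..T} (\<lambda>t. frozen_pairing k \<eta> t (vn n t) * (- w' n t) $ k))"
      unfolding A_def by (rule integral_cyl_time_derivative_split[OF \<eta> vn cont])
    also have "\<dots> = A (vn n) + (\<Sum>k\<in>UNIV. J n k)" by (simp add: J_def sum_negf)
    finally show ?thesis using transformed[OF tf1] by (simp add: B_def C_def exp_vn)
  qed
  have "(\<lambda>n. - (A (vn n) + (\<Sum>k\<in>UNIV. J n k)) - B (vn n)) \<longlonglongrightarrow> - (A (\<lambda>_. 0) + (\<Sum>k\<in>UNIV. R k)) - B (\<lambda>_. 0)"
    unfolding A_def B_def J_def R_def
    by (intro tendsto_intros time_integral_tendsto[OF \<eta>] initial_integral_tendsto[OF \<eta> X0]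
      pairing_integrals_tendsto(1)[OF \<eta>] vn vlim)
  moreover have "(\<lambda>n. C (vn n)) \<longlonglongrightarrow> C (\<lambda>_. 0)"
    unfolding C_def by (intro laplacian_integral_tendsto[OF \<eta> u] vn vlim)
  ultimately have lim_eq: "- (A (\<lambda>_. 0) + (\<Sum>k\<in>UNIV. R k)) - B (\<lambda>_. 0) = C (\<lambda>_. 0)"
    unfolding eq by (rule LIMSEQ_unique)
  have "\<mu> f (\<lambda>_. 0) t x = 0" for t x by (simp add: \<mu>_def)
  moreover have "(\<lambda>t. frozen_pairing k \<eta> t 0) = space_pairing \<Omega> (f k) X \<eta>" for k
    by (simp add: frozen_pairing_def fun_eq_iff calculation)
  ultimately show ?thesis using lim_eq by (simp add: A_def B_def C_def R_def algebra_simps)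
qed

end

theorem theorem2p2:
  fixes \<Omega> :: "'a::euclidean_space set"
    and T m :: real
    and f :: "'n::finite \<Rightarrow> 'a \<Rightarrow> real"
    and z :: "real \<Rightarrow> real ^ 'n"
    and X0 :: "'a \<Rightarrow> real"
    and X :: "real \<Rightarrow> 'a \<Rightarrow> real"
  assumes "smooth_bounded_domain \<Omega>"
    and "T > 0"
    and "m > 1"
    and "\<And>k. smooth_upto \<Omega> (closure \<Omega>) (f k)"
    and "L1 \<Omega> X0"
    and "continuous_on {0..T} z"
    and "bounded_variation_on_interval 0 T z"
    and "L1_cyl T \<Omega> X"
    and "\<And>k \<eta>. test_function 0 T \<Omega> \<eta> \<Longrightarrow> continuous_pairing T \<Omega> (f k) X \<eta>"
  shows "very_weak_solution_rough m T \<Omega> f z X0 X \<longleftrightarrow>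
    very_weak_solution_transformed m T \<Omega> f z
      (\<lambda>x. exp (\<mu> f z 0 x) * X0 x) (\<lambda>t x. exp (\<mu> f z t x) * X t x)"
proof -
  obtain w w' V where w:
    "\<And>n t. t \<in> {0..T} \<Longrightarrow> (w n has_vector_derivative w' n t) (at t within {0..T})"
    "\<And>n. continuous_on {0..T} (w n)"
    "\<And>n::nat. continuous_on {0..T} (w' n)"
    "\<And>n. integral {0..T} (\<lambda>t. norm (w' n t)) \<le> V"
    "uniform_limit {0..T} w z sequentially"
    by (rule C1_approximation_of_bounded_variation[OF assms(2,6,7)]) (rule that)
  interpret noise_approximation \<Omega> T f X z w w' V
    using assms w by unfold_locales (auto simp: smooth_bounded_domain_def)
  define u where "u r x = \<Phi> m (X r x)" for r x
  have cancel: "exp (- \<mu> f z r x) * (exp (\<mu> f z r x) * X r x) = X r x" for r x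
    by (simp add: exp_minus field_simps)
  have "continuous_on cyl (\<lambda>(t, x). exp (\<mu> f z t x))"
    using continuous_on_mu[where f = f, OF f_continuous z_cont] by (simp add: case_prod_unfold continuous_on_exp)
  from L1_cyl_mult_continuous[OF X_L1 this]
  have Y: "L1_cyl T \<Omega> (\<lambda>t x. exp (\<mu> f z t x) * X t x)" by (simp add: mult.commute)
  have "continuous_on (closure \<Omega>) (\<lambda>x. exp (\<mu> f z 0 x))"
    unfolding \<mu>_def by (intro continuous_intros f_continuous)
  from set_integrable_mult_continuous[OF assms(5)[unfolded L1_def] _ closure_subset _ this]
  have Y0: "L1 \<Omega> (\<lambda>x. exp (\<mu> f z 0 x) * X0 x)"
    using open_domain bounded_domain by (simp add: L1_def mult.commute)
  have transformed: "very_weak_solution_transformed m T \<Omega> f z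
      (\<lambda>x. exp (\<mu> f z 0 x) * X0 x) (\<lambda>t x. exp (\<mu> f z t x) * X t x) \<longleftrightarrow>
    L1_cyl T \<Omega> u \<and> (\<forall>\<eta>. test_function 1 T \<Omega> \<eta> \<longrightarrow>
      - integral_cyl T \<Omega> (\<lambda>r x. X r x * (exp (\<mu> f z r x) * time_derivative T \<eta> r x))
         - (LINT x:\<Omega>|lebesgue. X0 x * (exp (\<mu> f z 0 x) * \<eta> 0 x))
       = integral_cyl T \<Omega> (\<lambda>r x. u r x * laplacian (\<lambda>y. exp (\<mu> f z r y) * \<eta> r y) x))"
    unfolding very_weak_solution_transformed_def cancel u_def using Y Y0 by (simp add: mult_ac)
  have rough: "very_weak_solution_rough m T \<Omega> f z X0 X \<longleftrightarrow>
    L1_cyl T \<Omega> u \<and> (\<forall>\<eta>. test_function 1 T \<Omega> \<eta> \<longrightarrow>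
       - integral_cyl T \<Omega> (\<lambda>r x. X r x * time_derivative T \<eta> r x)
         - (LINT x:\<Omega>|lebesgue. X0 x * \<eta> 0 x)
       = integral_cyl T \<Omega> (\<lambda>r x. u r x * laplacian (\<eta> r) x)
         + (\<Sum>k\<in>UNIV. RS_integral (space_pairing \<Omega> (f k) X \<eta>) (\<lambda>r. z r $ k) 0 T))"
    unfolding very_weak_solution_rough_def u_def using assms(5) X_L1 pairing[OF test_function_weaken] by blast
  show ?thesis
    unfolding rough transformed
    using rough_imp_transformed_identity[OF _ assms(5), of _ u] transformed_imp_rough_identity[OF _ assms(5), of _ u]
    by blast
qed

end
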